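(* For each integer $n\ge 1$ let $S_n$ be the germ at $0\in\mathbb C^2$ of the smooth Levi flat hypersurface $$S_n=\bigcup_{t}\{(z,w)\in\mathbb C^2:\ w=t+g_n(t)z\},\qquad g_n(t)=e^{-\frac{1}{t^{2n}}}\ (t\neq 0),\quad g_n(0)=0,$$ where $t$ ranges over a neighborhood of $0$ in $\mathbb R$ (and $z$ over a neighborhood of $0$ in $\mathbb C$), with side $U_n$ the one containing the points $(0,\eta)$ with $\eta$ small and $\mathrm{Im}\,\eta>0$. Then the hypersurfaces $S_n$ are not equivalent to each other: if $n_1\neq n_2$, then $(S_{n_1},U_{n_1})$ and $(S_{n_2},U_{n_2})$ are not locally equivalent.
   Context: Coordinates on $\mathbb C^2$ are $(z=x+iy,\ w=u+iv)$. A Levi flat hypersurface is a real hypersurface foliated by complex hypersurfaces. Local equivalence: let $S_1,S_2\ni 0$ be smooth Levi flat hypersurfaces embedded in a domain $\mathcal U\subset\mathbb C^2$, each dividing $\mathcal U$ into two connected components, and let $U_i$ be a choice of one of the components of $\mathcal U\setminus S_i$. Then $(S_1,U_1)$ and $(S_2,U_2)$ are locally equivalent if there exist neighborhoods $\mathcal V_i$ of $0$ in $\mathbb C^2$ such that, putting $V_i=\mathcal V_i\cap U_i$, there is a biholomorphism $\Phi:V_1\to V_2$ which admits an extension (again denoted $\Phi$) to a $C^\infty$ CR map from $S_1\cap\mathcal V_1$ to $S_2\cap\mathcal V_2$, with $\Phi(0)=0$. *)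

theory Defs
  imports "HOL-Analysis.Analysis"
begin

type_synonym C2 = "complex \<times> complex"

primrec Ck_on :: "nat \<Rightarrow> 'a::euclidean_space set \<Rightarrow> ('a \<Rightarrow> 'b::euclidean_space) \<Rightarrow> bool" where
  "Ck_on 0 W f \<longleftrightarrow> continuous_on W f"
| "Ck_on (Suc k) W f \<longleftrightarrow>
     (\<forall>x\<in>W. f differentiable (at x)) \<and>
     (\<forall>v. Ck_on k W (\<lambda>x. frechet_derivative f (at x) v))"

definition smooth_on :: "'a::euclidean_space set \<Rightarrow> ('a \<Rightarrow> 'b::euclidean_space) \<Rightarrow> bool" where
  "smooth_on W f \<longleftrightarrow> open W \<and> (\<forall>k. Ck_on k W f)"

text \<open>Multiplication by the imaginary unit, i.e. the standard complex structure; the type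
  \<^typ>\<open>C2\<close> itself only carries a real vector space structure.\<close>

definition mult_i :: "C2 \<Rightarrow> C2" where
  "mult_i v = (\<i> * fst v, \<i> * snd v)"

definition holomorphic_map_on :: "C2 set \<Rightarrow> (C2 \<Rightarrow> C2) \<Rightarrow> bool" where
  "holomorphic_map_on V F \<longleftrightarrow>
     (\<forall>p\<in>V. \<exists>D. (F has_derivative D) (at p) \<and> (\<forall>v. D (mult_i v) = mult_i (D v)))"

definition biholomorphism :: "C2 set \<Rightarrow> C2 set \<Rightarrow> (C2 \<Rightarrow> C2) \<Rightarrow> bool" where
  "biholomorphism V V' F \<longleftrightarrow>
     open V \<and> open V' \<and> bij_betw F V V' \<and>
     holomorphic_map_on V F \<and> holomorphic_map_on V' (inv_into V F)"

definition smooth_hypersurface :: "C2 set \<Rightarrow> bool" where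
  "smooth_hypersurface M \<longleftrightarrow>
     (\<forall>p\<in>M. \<exists>W (\<rho> :: C2 \<Rightarrow> real). p \<in> W \<and> smooth_on W \<rho> \<and>
        (\<forall>q\<in>W. frechet_derivative \<rho> (at q) \<noteq> (\<lambda>v. 0)) \<and>
        M \<inter> W = {q \<in> W. \<rho> q = 0})"

text \<open>Foliation by complex hypersurfaces, given by local parametrizations
  \<open>\<psi> :: I \<times> D \<rightarrow> M\<close> whose plaques \<open>\<psi> ({t} \<times> D)\<close> are complex curves. No compatibility between
  charts has to be imposed: a complex curve contained in \<open>M\<close> is tangent to the maximal complex
  subspaces of the tangent spaces of \<open>M\<close>, so the plaques of any two charts agree on overlaps.\<close>

definition foliated_by_complex_hypersurfaces :: "C2 set \<Rightarrow> bool" where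
  "foliated_by_complex_hypersurfaces M \<longleftrightarrow>
     (\<forall>p\<in>M. \<exists>W (I :: real set) (D :: complex set) (\<psi> :: real \<times> complex \<Rightarrow> C2).
        open W \<and> p \<in> W \<and> open I \<and> connected I \<and> open D \<and> connected D \<and>
        smooth_on (I \<times> D) \<psi> \<and>
        (\<forall>x\<in>I \<times> D. inj (frechet_derivative \<psi> (at x))) \<and>
        bij_betw \<psi> (I \<times> D) (M \<inter> W) \<and>
        (\<forall>t\<in>I. (\<lambda>\<zeta>. fst (\<psi> (t, \<zeta>))) holomorphic_on D \<and>
               (\<lambda>\<zeta>. snd (\<psi> (t, \<zeta>))) holomorphic_on D))"

definition levi_flat_hypersurface :: "C2 set \<Rightarrow> bool" where
  "levi_flat_hypersurface M \<longleftrightarrow> smooth_hypersurface M \<and> foliated_by_complex_hypersurfaces M"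

definition levi_flat_side :: "C2 set \<Rightarrow> C2 set \<Rightarrow> C2 set \<Rightarrow> bool" where
  "levi_flat_side \<U> S U \<longleftrightarrow>
     0 \<in> S \<and> levi_flat_hypersurface S \<and> closedin (top_of_set \<U>) S \<and>
     card (components (\<U> - S)) = 2 \<and> U \<in> components (\<U> - S)"

definition tangent_space :: "C2 set \<Rightarrow> C2 \<Rightarrow> C2 set" where
  "tangent_space M p =
     {v. \<exists>\<gamma> :: real \<Rightarrow> C2. \<gamma> 0 = p \<and> (\<forall>\<^sub>F s in at 0. \<gamma> s \<in> M) \<and>
           (\<gamma> has_vector_derivative v) (at 0)}"

definition complex_tangent_space :: "C2 set \<Rightarrow> C2 \<Rightarrow> C2 set" where
  "complex_tangent_space M p = tangent_space M p \<inter> mult_i ` tangent_space M p"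

text \<open>Smoothness of a map on a hypersurface is expressed through local smooth extensions \<open>G\<close> to
  the ambient space. On tangent vectors of \<open>M\<close> the derivative of \<open>G\<close> does not depend on the
  extension: it is the differential of the map on \<open>M\<close>.\<close>

definition smooth_CR_map :: "C2 set \<Rightarrow> C2 set \<Rightarrow> (C2 \<Rightarrow> C2) \<Rightarrow> bool" where
  "smooth_CR_map M M' F \<longleftrightarrow>
     F ` M \<subseteq> M' \<and>
     (\<forall>p\<in>M. \<exists>W G. p \<in> W \<and> smooth_on W G \<and> (\<forall>q\<in>M \<inter> W. G q = F q) \<and>
        (\<forall>v\<in>complex_tangent_space M p.
           frechet_derivative G (at p) v \<in> complex_tangent_space M' (F p) \<and>
           frechet_derivative G (at p) (mult_i v) = mult_i (frechet_derivative G (at p) v)))"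

text \<open>\<open>\<Phi>\<close> denotes both the biholomorphism and its extension to the boundary piece
  \<open>S\<^sub>1 \<inter> \<V>\<^sub>1\<close>, which is disjoint from \<open>U\<^sub>1\<close>; that it is an extension means that it is
  continuous on the union of both.\<close>

definition locally_equivalent :: "C2 set \<times> C2 set \<Rightarrow> C2 set \<times> C2 set \<Rightarrow> bool" where
  "locally_equivalent = (\<lambda>(S\<^sub>1, U\<^sub>1) (S\<^sub>2, U\<^sub>2).
     \<exists>\<V>\<^sub>1 \<V>\<^sub>2 \<Phi>. open \<V>\<^sub>1 \<and> 0 \<in> \<V>\<^sub>1 \<and> open \<V>\<^sub>2 \<and> 0 \<in> \<V>\<^sub>2 \<and>
       biholomorphism (\<V>\<^sub>1 \<inter> U\<^sub>1) (\<V>\<^sub>2 \<inter> U\<^sub>2) \<Phi> \<and>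
       continuous_on ((\<V>\<^sub>1 \<inter> U\<^sub>1) \<union> (S\<^sub>1 \<inter> \<V>\<^sub>1)) \<Phi> \<and>
       smooth_CR_map (S\<^sub>1 \<inter> \<V>\<^sub>1) (S\<^sub>2 \<inter> \<V>\<^sub>2) \<Phi> \<and>
       \<Phi> 0 = 0)"

definition same_germ_at :: "'a::topological_space \<Rightarrow> 'a set \<Rightarrow> 'a set \<Rightarrow> bool" where
  "same_germ_at p A B \<longleftrightarrow> (\<exists>W. open W \<and> p \<in> W \<and> A \<inter> W = B \<inter> W)"

definition g_exp :: "nat \<Rightarrow> real \<Rightarrow> real" where
  "g_exp n t = (if t = 0 then 0 else exp (- (1 / t ^ (2 * n))))"

definition leaf_union :: "nat \<Rightarrow> real set \<Rightarrow> complex set \<Rightarrow> C2 set" where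
  "leaf_union n T Z =
     (\<Union>t\<in>T. {(z, w). z \<in> Z \<and> w = complex_of_real t + complex_of_real (g_exp n t) * z})"

text \<open>The germ of \<open>leaf_union n T Z\<close> at the origin is the same for all neighbourhoods \<open>T\<close> and
  \<open>Z\<close> of \<open>0\<close>, since \<open>0 \<le> g_exp n t < 1\<close> forces \<open>\<bar>t\<bar> \<le> cmod w + cmod z\<close>.\<close>

definition represents_S :: "nat \<Rightarrow> C2 set \<Rightarrow> bool" where
  "represents_S n S \<longleftrightarrow>
     (\<exists>T Z. open T \<and> 0 \<in> T \<and> open Z \<and> 0 \<in> Z \<and> same_germ_at 0 S (leaf_union n T Z))"

definition upper_side :: "C2 set \<Rightarrow> bool" where
  "upper_side U \<longleftrightarrow> (\<exists>\<epsilon>>0. \<forall>\<eta>. cmod \<eta> < \<epsilon> \<and> Im \<eta> > 0 \<longrightarrow> (0, \<eta>) \<in> U)"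

end

theory Submission
  imports Defs "HOL-Complex_Analysis.Conformal_Mappings"
begin

text \<open>For real \<open>x\<close> the slice \<open>{z = x}\<close> of \<open>U\<^sub>1\<close> near \<open>0\<close> is an upper half disc, and the leaf with
  parameter \<open>t\<close> meets its diameter in \<open>t + g(t) x\<close>. Let \<open>(a\<^sub>x, h\<^sub>x)\<close> be the restriction of an
  equivalence to this slice. The CR condition sends leaves into leaves, hence
  \<open>h\<^sub>x (t + g\<^sub>1(t) x) = \<phi>(t) + g\<^sub>2(\<phi>(t)) a\<^sub>x (t + g\<^sub>1(t) x)\<close> with \<open>\<phi>\<close> independent of \<open>x\<close>. Since \<open>(a\<^sub>0, h\<^sub>0)\<close>
  avoids the second hypersurface, \<open>h\<^sub>0\<close> stays on one side of a tangent disc, and the Hopf lemma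
  gives \<open>h\<^sub>0'(0) \<noteq> 0\<close>; thus \<open>\<bar>\<phi>(t)\<bar>\<close> is comparable to \<open>\<bar>t\<bar>\<close>.

  A holomorphic function on the half disc with boundary values \<open>O(exp(-c/t\<^sup>2))\<close> vanishes. Applied
  to \<open>h\<^sub>x - h\<^sub>0\<close> this gives \<open>h\<^sub>x = h\<^sub>0\<close>, and then \<open>g\<^sub>2(\<phi>(t)) (a\<^sub>x - a\<^sub>0)\<close> is of the exact order \<open>g\<^sub>1(t)\<close>
  on the boundary. If \<open>n\<^sub>1 < n\<^sub>2\<close>, then \<open>a\<^sub>x - a\<^sub>0\<close> would be unbounded; if \<open>n\<^sub>1 > n\<^sub>2\<close>, then it is flat
  on the boundary, so \<open>a\<^sub>x = a\<^sub>0\<close>, which contradicts injectivity.\<close>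

subsection \<open>Holomorphic functions on a half disc\<close>

text \<open>Closed, so that the boundary values of a function are part of the function; holomorphy
  is asked on the interior only.\<close>

definition half_disc :: "real \<Rightarrow> complex set" where
  "half_disc R = cball 0 R \<inter> {w. 0 \<le> Im w}"

lemma mem_half_disc: "w \<in> half_disc R \<longleftrightarrow> cmod w \<le> R \<and> 0 \<le> Im w"
  by (simp add: half_disc_def)

lemma interior_half_disc: "interior (half_disc R) = {w. cmod w < R \<and> 0 < Im w}"
  using interior_halfspace_ge[of \<i> 0]
  by (auto simp: half_disc_def inner_complex_def)

lemma compact_half_disc: "compact (half_disc R)"
  unfolding half_disc_def by (intro compact_Int_closed compact_cball closed_halfspace_Im_ge)

lemma convex_half_disc: "convex (half_disc R)"
  unfolding half_disc_def by (intro convex_Int convex_cball convex_halfspace_Im_ge)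

lemma closure_interior_half_disc:
  assumes "R > 0"
  shows "closure (interior (half_disc R)) = half_disc R"
proof -
  have "\<i> * of_real (R / 2) \<in> interior (half_disc R)"
    using assms by (simp add: interior_half_disc norm_mult)
  then have "interior (half_disc R) \<noteq> {}"
    by blast
  then show ?thesis
    using convex_closure_interior[OF convex_half_disc] compact_half_disc[THEN compact_imp_closed]
    by simp
qed

lemma connected_interior_half_disc: "connected (interior (half_disc R))"
  by (intro convex_connected convex_interior convex_half_disc)

text \<open>The frontier consists of the diameter and the arc. They are kept apart because the
  bounds have different sources: a hypothesis on the diameter, compactness on the arc.\<close>

lemma half_disc_maximum_modulus:
  assumes "f holomorphic_on interior (half_disc R)" and "continuous_on (half_disc R) f"
    and "\<And>s. \<bar>s\<bar> \<le> R \<Longrightarrow> cmod (f (of_real s)) \<le> B"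
    and "\<And>w. cmod w = R \<Longrightarrow> 0 \<le> Im w \<Longrightarrow> cmod (f w) \<le> B"
    and "w \<in> half_disc R"
  shows "cmod (f w) \<le> B"
proof (rule maximum_modulus_frontier[OF assms(1)])
  have cl: "closure (half_disc R) = half_disc R"
    using compact_half_disc[THEN compact_imp_closed] by simp
  then show "continuous_on (closure (half_disc R)) f"
    using assms(2) by simp
  show "bounded (half_disc R)"
    by (rule compact_imp_bounded[OF compact_half_disc])
  fix z assume "z \<in> frontier (half_disc R)"
  then have z: "cmod z \<le> R" "0 \<le> Im z" "\<not> (cmod z < R \<and> 0 < Im z)"
    unfolding frontier_def cl by (auto simp: mem_half_disc interior_half_disc)
  show "cmod (f z) \<le> B"
  proof (cases "Im z = 0")
    case True
    then have "z = of_real (Re z)"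
      by (simp add: complex_eq_iff)
    moreover have "\<bar>Re z\<bar> \<le> R"
      using abs_Re_le_cmod z(1) order_trans by blast
    ultimately show ?thesis
      using assms(3) by metis
  qed (use z assms(4) in auto)
qed (use assms in auto)

section \<open>From bounds on the diameter to bounds on the half disc\<close>

lemma cmod_add_imaginary_ge:
  assumes "0 \<le> Im w" "0 \<le> \<delta>"
  shows "cmod w \<le> cmod (w + \<i> * of_real \<delta>)"
  using assms by (auto simp: cmod_def power2_eq_square algebra_simps intro!: real_sqrt_le_mono)

text \<open>An argument of Phragmen-Lindelof type. The factor \<open>exp (c / \<delta> * E)\<close>
  compensates the decay of \<open>f\<close> on the diameter, so that the maximum principle bounds
  the product independently of \<open>\<delta>\<close>. At an interior point the factor is unbounded
  as \<open>\<delta>\<close> tends to 0, which leaves only the value 0 for \<open>f\<close>.\<close>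

lemma half_disc_flat_imp_zero:
  assumes hol: "f holomorphic_on interior (half_disc R)" and cont: "continuous_on (half_disc R) f"
    and "R > 0" "c > 0"
    and flat: "\<And>s. \<bar>s\<bar> \<le> R \<Longrightarrow> s \<noteq> 0 \<Longrightarrow> cmod (f (of_real s)) \<le> C * exp (- c / s\<^sup>2)"
    and w: "w \<in> half_disc R"
  shows "f w = 0"
proof -
  define E where "E \<delta> w = \<i> / (w + \<i> * of_real \<delta>) + \<i> * w / of_real (R\<^sup>2)" for \<delta> w
  \<comment> \<open>\<open>Re (E \<delta> w) / \<delta>\<close> is harmonic and at most \<open>1/s\<^sup>2\<close> on the diameter and \<open>1/R\<^sup>2\<close> on the arc, but tends
    to infinity at interior points as \<open>\<delta>\<close> tends to \<open>0\<close>.\<close>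
  have ReE: "Re (E \<delta> w) = (Im w + \<delta>) / (cmod (w + \<i> * of_real \<delta>))\<^sup>2 - Im w / R\<^sup>2" for \<delta> w
    unfolding E_def cmod_power2 by (simp add: Re_divide power2_eq_square)
  obtain M where M: "\<And>w. w \<in> half_disc R \<Longrightarrow> cmod (f w) \<le> M"
    using compact_imp_bounded[OF compact_continuous_image[OF cont compact_half_disc]]
    by (auto simp: bounded_iff)
  define B where "B = max C (M * exp (c / R\<^sup>2))"
  have bound: "cmod (f w * exp (of_real (c / \<delta>) * E \<delta> w)) \<le> B"
    if "\<delta> > 0" "w \<in> half_disc R" for \<delta> w
  proof (rule half_disc_maximum_modulus[where w = w and R = R])
    let ?F = "\<lambda>w. f w * exp (of_real (c / \<delta>) * E \<delta> w)"
    have nz: "w + \<i> * of_real \<delta> \<noteq> 0" if "0 \<le> Im w" for w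
      using that \<open>\<delta> > 0\<close> by (auto simp: complex_eq_iff)
    show "?F holomorphic_on interior (half_disc R)"
      unfolding E_def using hol nz \<open>R > 0\<close>
      by (intro holomorphic_intros) (auto simp: interior_half_disc less_imp_le)
    show contF: "continuous_on (half_disc R) ?F"
      unfolding E_def using cont nz \<open>R > 0\<close>
      by (intro continuous_intros) (auto simp: mem_half_disc less_imp_le)
    have real: "cmod (?F (of_real s)) \<le> B" if "\<bar>s\<bar> \<le> R" "s \<noteq> 0" for s
    proof -
      have "Re (E \<delta> (of_real s)) = \<delta> / (s\<^sup>2 + \<delta>\<^sup>2)"
        by (simp add: ReE cmod_power2)
      also have "\<dots> \<le> \<delta> / s\<^sup>2"
        using that \<open>\<delta> > 0\<close>
          by (intro divide_left_mono) (auto intro!: mult_pos_pos add_nonneg_pos)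
      finally have "c / \<delta> * Re (E \<delta> (of_real s)) \<le> c / \<delta> * (\<delta> / s\<^sup>2)"
        using \<open>\<delta> > 0\<close> \<open>c > 0\<close> by (intro mult_left_mono) auto
      then have "c / \<delta> * Re (E \<delta> (of_real s)) \<le> c / s\<^sup>2"
        using \<open>\<delta> > 0\<close> by simp
      then have "cmod (?F (of_real s)) \<le> C * exp (- c / s\<^sup>2) * exp (c / s\<^sup>2)"
        unfolding norm_mult using flat[OF that]
        by (intro mult_mono order_trans[OF norm_ge_zero flat[OF that]]) auto
      also have "\<dots> = C"
        by (simp flip: exp_add mult.assoc)
      finally show ?thesis
        by (simp add: B_def)
    qed
    show "cmod (?F (of_real s)) \<le> B" if "\<bar>s\<bar> \<le> R" for s
    \<comment> \<open>The decay hypothesis says nothing at 0; the bound there is a limit of the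
      bounds for small positive \<open>s\<close>.\<close>
    proof (cases "s = 0")
      case True
      have "continuous_on {0..R} (\<lambda>s::real. ?F (of_real s))"
        by (rule continuous_on_compose2[OF contF])
          (auto simp: mem_half_disc intro!: continuous_intros)
      then show ?thesis
        using continuous_on_closure_norm_le[of "{0<..R}" "\<lambda>s::real. ?F (of_real s)" B 0]
          real \<open>R > 0\<close> True by (simp add: closure_greaterThanAtMost)
    qed (use real that in auto)
    show "cmod (?F w) \<le> B" if "cmod w = R" "0 \<le> Im w" for w
    proof -
      have "R\<^sup>2 \<le> (cmod (w + \<i> * of_real \<delta>))\<^sup>2"
        using cmod_add_imaginary_ge[of w \<delta>] that \<open>\<delta> > 0\<close> by (intro power_mono) auto
      then have "(Im w + \<delta>) / (cmod (w + \<i> * of_real \<delta>))\<^sup>2 \<le> (Im w + \<delta>) / R\<^sup>2"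
        using that \<open>\<delta> > 0\<close> \<open>R > 0\<close> by (intro divide_left_mono) (auto intro!: mult_pos_pos nz)
      then have "Re (E \<delta> w) \<le> \<delta> / R\<^sup>2"
        unfolding ReE by (simp add: add_divide_distrib)
      then have "c / \<delta> * Re (E \<delta> w) \<le> c / \<delta> * (\<delta> / R\<^sup>2)"
        using \<open>\<delta> > 0\<close> \<open>c > 0\<close> by (intro mult_left_mono) auto
      then have "c / \<delta> * Re (E \<delta> w) \<le> c / R\<^sup>2"
        using \<open>\<delta> > 0\<close> by simp
      then have "cmod (?F w) \<le> M * exp (c / R\<^sup>2)"
        unfolding norm_mult using M[of w] that
        by (intro mult_mono order_trans[OF norm_ge_zero M[of w]]) (auto simp: mem_half_disc)
      then show ?thesis
        by (simp add: B_def)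
    qed
  qed (use that in auto)
  have "f w = 0" if "w \<in> interior (half_disc R)" for w
  proof -
    have w: "cmod w < R" "0 < Im w" "w \<in> half_disc R"
      using that interior_subset[of "half_disc R"] by (auto simp: interior_half_disc)
    have "w \<noteq> 0"
      using w by auto
    \<comment> \<open>The limit is \<open>Im w\<close> times the difference of the inverse squares
      of \<open>cmod w\<close> and \<open>R\<close>, hence positive inside the half disc.\<close>
    have "((\<lambda>\<delta>. Re (E \<delta> w)) \<longlongrightarrow> (Im w + 0) / (cmod (w + \<i> * of_real 0))\<^sup>2 - Im w / R\<^sup>2) (at_right 0)"
      unfolding ReE using \<open>w \<noteq> 0\<close> by (intro tendsto_intros) auto
    moreover have "(Im w + 0) / (cmod (w + \<i> * of_real 0))\<^sup>2 - Im w / R\<^sup>2 > 0"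
      using w \<open>w \<noteq> 0\<close> by (auto intro!: divide_strict_left_mono power_strict_mono mult_pos_pos)
    moreover have "filterlim (\<lambda>\<delta>. c / \<delta>) at_top (at_right 0)"
      using filterlim_tendsto_pos_mult_at_top[OF tendsto_const \<open>c > 0\<close> filterlim_inverse_at_top_right]
      by (simp add: field_simps)
    ultimately have "filterlim (\<lambda>\<delta>. Re (E \<delta> w) * (c / \<delta>)) at_top (at_right 0)"
      by (rule filterlim_tendsto_pos_mult_at_top)
    then have "((\<lambda>\<delta>. exp (- (Re (E \<delta> w) * (c / \<delta>)))) \<longlongrightarrow> 0) (at_right 0)"
      by (intro filterlim_compose[OF exp_at_bot] filterlim_compose[OF filterlim_uminus_at_bot_at_top])
    then have "((\<lambda>\<delta>. B * exp (- (Re (E \<delta> w) * (c / \<delta>)))) \<longlongrightarrow> B * 0) (at_right 0)"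
      by (intro tendsto_intros)
    moreover have "\<forall>\<^sub>F \<delta> in at_right 0. cmod (f w) \<le> B * exp (- (Re (E \<delta> w) * (c / \<delta>)))"
      unfolding eventually_at_right_field
    proof (intro exI[of _ 1] conjI allI impI)
      fix \<delta> :: real assume "0 < \<delta>" "\<delta> < 1"
      have "cmod (f w) * exp (Re (E \<delta> w) * (c / \<delta>)) \<le> B"
        using bound[OF \<open>0 < \<delta>\<close> w(3)] by (simp add: norm_mult mult.commute)
      then show "cmod (f w) \<le> B * exp (- (Re (E \<delta> w) * (c / \<delta>)))"
        by (simp add: exp_minus field_simps)
    qed simp
    ultimately have "cmod (f w) \<le> B * 0"
      by (intro tendsto_lowerbound) auto
    then show ?thesis
      by simp
  qed
  then show ?thesis
    using continuous_constant_on_closure[of "interior (half_disc R)" f 0 w] cont w \<open>R > 0\<close>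
    by (simp add: closure_interior_half_disc)
qed

text \<open>The maximum principle applied to the quotient of \<open>f\<close> by the square of
  \<open>w + \<i> * \<delta>\<close>: the pole lies outside the half disc, and the bound does not
  depend on \<open>\<delta>\<close>, so \<open>\<delta>\<close> can tend to 0. This carries the
  vanishing order from the diameter to the imaginary axis, where the Hopf lemma needs it.\<close>

lemma half_disc_quadratic_bound:
  assumes hol: "f holomorphic_on interior (half_disc R)" and cont: "continuous_on (half_disc R) f"
    and "R > 0"
    and bd: "\<And>s. \<bar>s\<bar> \<le> R \<Longrightarrow> cmod (f (of_real s)) \<le> K * s\<^sup>2"
  obtains K' where "\<And>w. w \<in> half_disc R \<Longrightarrow> cmod (f w) \<le> K' * (cmod w)\<^sup>2"
proof -
  obtain M where M: "\<And>w. w \<in> half_disc R \<Longrightarrow> cmod (f w) \<le> M"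
    using compact_imp_bounded[OF compact_continuous_image[OF cont compact_half_disc]]
    by (auto simp: bounded_iff)
  have "K * R\<^sup>2 \<ge> 0"
    using order_trans[OF norm_ge_zero bd[of R]] \<open>R > 0\<close> by simp
  then have "K \<ge> 0"
    using \<open>R > 0\<close> by (simp add: zero_le_mult_iff)
  define B where "B = max K (M / R\<^sup>2)"
  have bound: "cmod (f w / (w + \<i> * of_real \<delta>)\<^sup>2) \<le> B"
    if "\<delta> > 0" "w \<in> half_disc R" for \<delta> w
  proof (rule half_disc_maximum_modulus[where w = w and R = R])
    have nz: "w + \<i> * of_real \<delta> \<noteq> 0" if "0 \<le> Im w" for w
      using that \<open>\<delta> > 0\<close> by (auto simp: complex_eq_iff)
    show "(\<lambda>w. f w / (w + \<i> * of_real \<delta>)\<^sup>2) holomorphic_on interior (half_disc R)"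
      using hol nz by (intro holomorphic_intros) (auto simp: interior_half_disc less_imp_le)
    show "continuous_on (half_disc R) (\<lambda>w. f w / (w + \<i> * of_real \<delta>)\<^sup>2)"
      using cont nz by (intro continuous_intros) (auto simp: mem_half_disc less_imp_le)
    show "cmod (f (of_real s) / (of_real s + \<i> * of_real \<delta>)\<^sup>2) \<le> B" if "\<bar>s\<bar> \<le> R" for s
    proof -
      have "cmod (f (of_real s)) \<le> K * (s\<^sup>2 + \<delta>\<^sup>2)"
        using bd[OF that] \<open>K \<ge> 0\<close> by (smt (verit) mult_left_mono zero_le_power2)
      moreover have "s\<^sup>2 + \<delta>\<^sup>2 > 0"
        using \<open>\<delta> > 0\<close> by (simp add: add_nonneg_pos)
      ultimately have "cmod (f (of_real s)) / (s\<^sup>2 + \<delta>\<^sup>2) \<le> K"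
        by (simp add: divide_le_eq)
      moreover have "cmod ((of_real s + \<i> * of_real \<delta>)\<^sup>2) = s\<^sup>2 + \<delta>\<^sup>2"
        by (simp add: norm_power cmod_power2)
      ultimately show ?thesis
        by (simp add: norm_divide B_def)
    qed
    show "cmod (f w / (w + \<i> * of_real \<delta>)\<^sup>2) \<le> B" if "cmod w = R" "0 \<le> Im w" for w
    proof -
      have "R\<^sup>2 \<le> (cmod (w + \<i> * of_real \<delta>))\<^sup>2"
        using cmod_add_imaginary_ge[of w \<delta>] that \<open>\<delta> > 0\<close> \<open>R > 0\<close> by (intro power_mono) auto
      then have "cmod (f w / (w + \<i> * of_real \<delta>)\<^sup>2) \<le> M / R\<^sup>2"
        unfolding norm_divide norm_power using M[of w] that \<open>R > 0\<close>
        by (intro frac_le) (auto simp: mem_half_disc order_trans[OF norm_ge_zero M[of w]])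
      then show ?thesis
        by (simp add: B_def)
    qed
  qed (use that in auto)
  have "cmod (f w) \<le> B * (cmod w)\<^sup>2" if w: "w \<in> half_disc R" for w
  proof -
    have "((\<lambda>\<delta>. B * (cmod (w + \<i> * of_real \<delta>))\<^sup>2) \<longlongrightarrow> B * (cmod (w + \<i> * of_real 0))\<^sup>2) (at_right 0)"
      by (intro tendsto_intros)
    moreover have "\<forall>\<^sub>F \<delta> in at_right 0. cmod (f w) \<le> B * (cmod (w + \<i> * of_real \<delta>))\<^sup>2"
      unfolding eventually_at_right_field
    proof (intro exI[of _ 1] conjI allI impI)
      fix \<delta> :: real assume "0 < \<delta>" "\<delta> < 1"
      have "w + \<i> * of_real \<delta> \<noteq> 0"
        using w \<open>\<delta> > 0\<close> by (auto simp: complex_eq_iff mem_half_disc)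
      then show "cmod (f w) \<le> B * (cmod (w + \<i> * of_real \<delta>))\<^sup>2"
        using bound[OF \<open>0 < \<delta>\<close> w] by (simp add: norm_divide norm_power divide_le_eq)
    qed simp
    ultimately have "cmod (f w) \<le> B * (cmod (w + \<i> * of_real 0))\<^sup>2"
      by (intro tendsto_lowerbound) auto
    then show ?thesis
      by simp
  qed
  then show ?thesis
    by (rule that)
qed

section \<open>The Hopf lemma at the origin\<close>

text \<open>Schwarz lemma for the composition of \<open>f\<close> with the affine map
  \<open>e\<close> of the unit disc onto the disc of radius \<open>R / 2\<close> tangent to the real
  axis at 0, followed by a Cayley transform sending \<open>P\<close> to 0. Near the point of
  tangency the distance of \<open>Q\<close> from 1 is at least of order \<open>y\<close>, which
  limits the size of \<open>f\<close> to order \<open>1 / y\<close>.\<close>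

lemma upper_half_plane_valued_growth:
  assumes hol: "f holomorphic_on interior (half_disc R)" and "R > 0"
    and pos: "\<And>w. w \<in> interior (half_disc R) \<Longrightarrow> 0 < Im (f w)"
  obtains C where "C > 0" "\<And>y. 0 < y \<Longrightarrow> y < R / 2 \<Longrightarrow> cmod (f (\<i> * of_real y)) \<le> C / y"
proof -
  define \<rho> where "\<rho> = R / 2"
  define e where "e \<zeta> = of_real \<rho> * (\<i> + \<zeta>)" for \<zeta> :: complex
  define P where "P = f (e 0)"
  define Q where "Q \<zeta> = (f (e \<zeta>) - P) / (f (e \<zeta>) - cnj P)" for \<zeta>
  have "\<rho> > 0"
    using \<open>R > 0\<close> by (simp add: \<rho>_def)
  have e_in: "e \<zeta> \<in> interior (half_disc R)" if "cmod \<zeta> < 1" for \<zeta>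
  proof -
    have "cmod (\<i> + \<zeta>) < 2"
      using norm_triangle_ineq[of \<i> \<zeta>] that by simp
    then have "cmod (e \<zeta>) < R"
      using \<open>\<rho> > 0\<close> by (simp add: e_def norm_mult) (simp add: \<rho>_def)
    moreover have "0 < Im (e \<zeta>)"
      using abs_Im_le_cmod[of \<zeta>] that \<open>\<rho> > 0\<close> by (auto simp: e_def intro!: mult_pos_pos)
    ultimately show ?thesis
      by (simp add: interior_half_disc)
  qed
  have ImP: "Im P > 0"
    using pos e_in[of 0] by (simp add: P_def)
  have Imf: "0 < Im (f (e \<zeta>))" if "cmod \<zeta> < 1" for \<zeta>
    using pos e_in that by blast
  have nz: "f (e \<zeta>) - cnj P \<noteq> 0" if "cmod \<zeta> < 1" for \<zeta>
    using Imf[OF that] ImP by (auto simp: complex_eq_iff)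
  have "Q holomorphic_on ball 0 1"
  proof -
    have "(f \<circ> e) holomorphic_on ball 0 1"
      by (rule holomorphic_on_compose_gen[OF _ hol])
        (use e_in in \<open>auto simp: e_def[abs_def] intro!: holomorphic_intros\<close>)
    then have "(\<lambda>\<zeta>. f (e \<zeta>)) holomorphic_on ball 0 1"
      by (simp add: o_def)
    then show ?thesis
      unfolding Q_def[abs_def] using nz by (intro holomorphic_intros) auto
  qed
  moreover have "Q 0 = 0"
    by (simp add: Q_def P_def)
  moreover have "cmod (Q \<zeta>) < 1" if "cmod \<zeta> < 1" for \<zeta>
  proof -
    let ?u = "f (e \<zeta>)"
    \<comment> \<open>A point of the upper half plane is closer to \<open>P\<close> than to its
      conjugate.\<close>
    have "(cmod (?u - P))\<^sup>2 = (cmod (?u - cnj P))\<^sup>2 - 4 * Im ?u * Im P"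
      unfolding cmod_power2 by (simp add: power2_eq_square algebra_simps)
    also have "\<dots> < (cmod (?u - cnj P))\<^sup>2"
      using Imf[OF that] ImP by simp
    finally have "cmod (?u - P) < cmod (?u - cnj P)"
      by (rule power_less_imp_less_base) simp
    then show ?thesis
      using nz[OF that] by (simp add: Q_def norm_divide)
  qed
  ultimately have Schwarz: "cmod (Q \<zeta>) \<le> cmod \<zeta>" if "cmod \<zeta> < 1" for \<zeta>
    using Schwarz_Lemma(1)[of Q \<zeta>] that by blast
  show ?thesis
  proof (rule that)
    show "0 < cmod P * \<rho> + 2 * \<rho> * Im P"
      using ImP \<open>\<rho> > 0\<close> by (simp add: add_nonneg_pos)
    fix y :: real assume y: "0 < y" "y < R / 2"
    \<comment> \<open>The preimage of the point \<open>\<i> * y\<close> under \<open>e\<close>; its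
      distance to the unit circle is \<open>y / \<rho>\<close>.\<close>
    define \<zeta> where "\<zeta> = \<i> * of_real ((y - \<rho>) / \<rho>)"
    have "cmod \<zeta> = \<bar>(y - \<rho>) / \<rho>\<bar>"
      by (simp only: \<zeta>_def norm_mult norm_of_real norm_ii mult_1)
    also have "\<dots> = 1 - y / \<rho>"
      using y \<open>\<rho> > 0\<close> by (simp add: abs_if \<rho>_def field_simps)
    finally have \<zeta>: "cmod \<zeta> = 1 - y / \<rho>" .
    then have "cmod \<zeta> < 1"
      using y \<open>\<rho> > 0\<close> by simp
    have e\<zeta>: "e \<zeta> = \<i> * of_real y"
      using \<open>\<rho> > 0\<close> by (simp add: e_def \<zeta>_def complex_eq_iff field_simps)
    let ?u = "f (\<i> * of_real y)"
    have nz': "cmod (?u - cnj P) > 0"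
      using nz[OF \<open>cmod \<zeta> < 1\<close>] e\<zeta> by simp
    have "y / \<rho> \<le> 1 - cmod (Q \<zeta>)"
      using Schwarz[OF \<open>cmod \<zeta> < 1\<close>] \<zeta> by simp
    also have "\<dots> \<le> cmod (1 - Q \<zeta>)"
      using norm_triangle_ineq2[of 1 "Q \<zeta>"] by simp
    also have "1 - Q \<zeta> = (P - cnj P) / (?u - cnj P)"
      using nz' by (simp add: Q_def e\<zeta> field_simps)
    also have "cmod \<dots> = 2 * Im P / cmod (?u - cnj P)"
      using ImP by (simp add: norm_divide complex_diff_cnj norm_mult)
    finally have "cmod (?u - cnj P) \<le> 2 * \<rho> * Im P / y"
      using y \<open>\<rho> > 0\<close> nz' by (simp add: field_simps)
    moreover have "cmod ?u \<le> cmod (?u - cnj P) + cmod P"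
      using norm_triangle_ineq[of "?u - cnj P" "cnj P"] by simp
    \<comment> \<open>Since \<open>y\<close> is below \<open>\<rho>\<close>, the additive constant
      can be absorbed into a multiple of \<open>1 / y\<close>.\<close>
    moreover have "cmod P \<le> cmod P * \<rho> / y"
      using y mult_left_mono[of y \<rho> "cmod P"] by (simp add: \<rho>_def le_divide_eq)
    ultimately show "cmod ?u \<le> (cmod P * \<rho> + 2 * \<rho> * Im P) / y"
      by (simp add: add_divide_distrib)
  qed
qed

text \<open>A form of the Hopf lemma: for \<open>h\<close> with values outside a disc touching the real axis from
  below at \<open>0\<close>, the map \<open>-1/h + iK\<close> has values in the upper half plane.\<close>

lemma hopf_not_quadratic:
  assumes hol: "h holomorphic_on interior (half_disc R)" and cont: "continuous_on (half_disc R) h"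
    and "R > 0" "K \<ge> 0"
    and side: "\<And>w. w \<in> interior (half_disc R) \<Longrightarrow> - (K * (cmod (h w))\<^sup>2) < Im (h w)"
    and quad: "\<And>s. \<bar>s\<bar> \<le> R \<Longrightarrow> cmod (h (of_real s)) \<le> M * s\<^sup>2"
  shows False
proof -
  have nz: "h w \<noteq> 0" if "w \<in> interior (half_disc R)" for w
    using side[OF that] by auto
  define P where "P w = \<i> * of_real K - 1 / h w" for w
  have "P holomorphic_on interior (half_disc R)"
    unfolding P_def[abs_def] using nz by (intro holomorphic_intros hol) auto
  moreover have "0 < Im (P w)" if "w \<in> interior (half_disc R)" for w
  proof -
    have "(cmod (h w))\<^sup>2 > 0"
      using nz[OF that] by simp
    then have "- K < Im (h w) / (cmod (h w))\<^sup>2"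
      using side[OF that] by (simp add: less_divide_eq)
    moreover have "Im (P w) = K + Im (h w) / (cmod (h w))\<^sup>2"
      by (simp add: P_def Im_divide cmod_power2)
    ultimately show ?thesis
      by simp
  qed
  ultimately obtain C where C: "C > 0"
    "\<And>y. 0 < y \<Longrightarrow> y < R / 2 \<Longrightarrow> cmod (P (\<i> * of_real y)) \<le> C / y"
    using upper_half_plane_valued_growth \<open>R > 0\<close> by metis
  obtain K' where K': "\<And>w. w \<in> half_disc R \<Longrightarrow> cmod (h w) \<le> K' * (cmod w)\<^sup>2"
    using half_disc_quadratic_bound[OF hol cont \<open>R > 0\<close> quad] by blast
  define D where "D = C + K * R"
  have "D > 0"
    using C(1) \<open>R > 0\<close> \<open>K \<ge> 0\<close> by (simp add: D_def add_pos_nonneg)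
  \<comment> \<open>On the imaginary axis the growth bound for \<open>P\<close> makes
    \<open>cmod (h (\<i> * y))\<close> at least \<open>y / D\<close>, whereas the quadratic bound
    makes it of order \<open>y\<close> squared. The two are incompatible for small
    \<open>y\<close>.\<close>
  have lower: "1 \<le> D * \<bar>K'\<bar> * y" if y: "0 < y" "y < R / 2" for y
  proof -
    have mem: "\<i> * of_real y \<in> interior (half_disc R)"
      using y by (simp add: interior_half_disc norm_mult)
    let ?u = "h (\<i> * of_real y)"
    have "1 / cmod ?u = cmod (\<i> * of_real K - P (\<i> * of_real y))"
      by (simp add: P_def norm_divide)
    also have "\<dots> \<le> K + C / y"
      using norm_triangle_ineq4[of "\<i> * of_real K" "P (\<i> * of_real y)"] C(2)[OF y] \<open>K \<ge> 0\<close>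
      by (simp add: norm_mult)
    also have "\<dots> \<le> D / y"
      using y mult_left_mono[of y R K] \<open>K \<ge> 0\<close>
      by (simp add: D_def add_divide_distrib le_divide_eq)
    finally have "y \<le> D * cmod ?u"
      using nz[OF mem] y by (simp add: field_simps)
    also have "cmod ?u \<le> K' * y\<^sup>2"
      using K'[of "\<i> * of_real y"] mem interior_subset[of "half_disc R"] y
      by (auto simp: norm_mult)
    also have "\<dots> \<le> \<bar>K'\<bar> * y\<^sup>2"
      by (simp add: mult_right_mono)
    finally have "y * 1 \<le> y * (D * \<bar>K'\<bar> * y)"
      using \<open>D > 0\<close> by (simp add: power2_eq_square mult.assoc mult.left_commute)
    then show ?thesis
      using y by (simp only: mult_le_cancel_left_pos)
  qed
  have "((\<lambda>y. D * \<bar>K'\<bar> * y) \<longlongrightarrow> D * \<bar>K'\<bar> * 0) (at_right 0)"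
    by (intro tendsto_intros)
  moreover have "\<forall>\<^sub>F y in at_right 0. 1 \<le> D * \<bar>K'\<bar> * y"
    unfolding eventually_at_right_field
    using lower \<open>R > 0\<close> by (intro exI[of _ "R / 2"]) auto
  ultimately have "1 \<le> D * \<bar>K'\<bar> * 0"
    by (intro tendsto_lowerbound) auto
  then show False
    by simp
qed

subsection \<open>The leaves\<close>

lemma g_exp_0 [simp]: "g_exp n 0 = 0"
  by (simp add: g_exp_def)

lemma g_exp_nonneg: "0 \<le> g_exp n t"
  by (simp add: g_exp_def)

lemma g_exp_less_1: "g_exp n t < 1"
  by (simp add: g_exp_def power_mult)

text \<open>For small \<open>t\<close> the case \<open>n = 1\<close> decays most slowly. Its
  exponent is the one treated by \<open>half_disc_flat_imp_zero\<close>, so that lemma serves all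
  \<open>n\<close>.\<close>

lemma g_exp_le_exp:
  assumes "n \<ge> 1" "\<bar>t\<bar> \<le> 1"
  shows "g_exp n t \<le> exp (- (1 / t\<^sup>2))"
proof (cases "t = 0")
  case False
  have "t ^ (2 * n) \<le> t ^ 2"
    using power_decreasing[of 2 "2 * n" "\<bar>t\<bar>"] assms by (simp add: power_even_abs)
  moreover have "0 < t ^ (2 * n)"
    using False by (simp add: power_mult)
  ultimately have "1 / t\<^sup>2 \<le> 1 / t ^ (2 * n)"
    using False by (intro divide_left_mono) (auto intro!: mult_pos_pos)
  then show ?thesis
    using False by (simp add: g_exp_def)
qed simp

lemma exp_minus_inverse_le:
  assumes "x > 0"
  shows "exp (- (1 / x)) \<le> (x::real)"
proof -
  have "1 / x \<le> exp (1 / x)"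
    using exp_ge_add_one_self[of "1 / x"] by linarith
  then show ?thesis
    using assms by (simp add: exp_minus field_simps)
qed

text \<open>The bound is global: outside the unit interval the right side is at least 1. It gives
  the derivative at 0 and the parabola-like region needed for the Hopf lemma.\<close>

lemma g_exp_le_square:
  assumes "n \<ge> 1"
  shows "g_exp n t \<le> t\<^sup>2"
proof (cases "\<bar>t\<bar> \<le> 1 \<and> t \<noteq> 0")
  case True
  then show ?thesis
    using g_exp_le_exp[OF assms, of t] exp_minus_inverse_le[of "t\<^sup>2"] by simp
next
  case False
  then show ?thesis
    using g_exp_less_1[of n t] abs_le_square_iff[of 1 t] by force
qed

text \<open>Away from 0, with \<open>u\<close> the inverse of the even power of \<open>t\<close>,
  the derivative has modulus \<open>2 * n * (u / \<bar>t\<bar>) * exp (- u)\<close>. For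
  \<open>\<bar>t\<bar> \<le> 1\<close> the factor \<open>1 / \<bar>t\<bar>\<close> is at most
  \<open>u\<close>, and the Taylor bound makes the square of \<open>u\<close> at most
  \<open>2 * exp u\<close>; for larger \<open>t\<close> both \<open>u / \<bar>t\<bar>\<close> and
  \<open>exp (- u)\<close> are at most 1.\<close>

lemma g_exp_has_derivative:
  assumes "n \<ge> 1"
  obtains d where "(g_exp n has_field_derivative d) (at t)" "\<bar>d\<bar> \<le> 4 * real n"
proof (cases "t = 0")
  case True
  have "(g_exp n has_field_derivative 0) (at 0)"
    unfolding DERIV_def
  proof (rule Lim_null_comparison)
    show "\<forall>\<^sub>F h in at 0. norm ((g_exp n (0 + h) - g_exp n 0) / h) \<le> \<bar>h\<bar>"
    proof (rule always_eventually, rule allI)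
      fix h :: real
      show "norm ((g_exp n (0 + h) - g_exp n 0) / h) \<le> \<bar>h\<bar>"
        using g_exp_le_square[OF assms, of h] g_exp_nonneg[of n h]
        by (cases "h = 0") (auto simp: divide_le_eq power2_eq_square simp flip: abs_mult)
    qed
    show "((\<lambda>h::real. \<bar>h\<bar>) \<longlongrightarrow> 0) (at 0)"
      by (intro tendsto_eq_intros) auto
  qed
  then show ?thesis
    using that True by simp
next
  case False
  define u where "u = 1 / \<bar>t\<bar> ^ (2 * n)"
  have "((\<lambda>t. exp (- (1 / t ^ (2 * n)))) has_field_derivative
      exp (- (1 / t ^ (2 * n))) * (real (2 * n) * t ^ (2 * n - 1) / (t ^ (2 * n))\<^sup>2)) (at t)"
    using False by (auto intro!: derivative_eq_intros simp: power2_eq_square)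
  then have der: "(g_exp n has_field_derivative
      exp (- (1 / t ^ (2 * n))) * (real (2 * n) * t ^ (2 * n - 1) / (t ^ (2 * n))\<^sup>2)) (at t)"
    by (rule has_field_derivative_transform_within_open[where S = "- {0}"])
      (use False in \<open>auto simp: g_exp_def\<close>)
  have "u > 0"
    using False by (simp add: u_def)
  have "u / \<bar>t\<bar> * exp (- u) \<le> 2"
  proof (cases "\<bar>t\<bar> \<le> 1")
    case True
    have "\<bar>t\<bar> ^ (2 * n) \<le> \<bar>t\<bar> ^ 1"
      using True assms by (intro power_decreasing) auto
    then have "1 / \<bar>t\<bar> \<le> u"
      unfolding u_def using False by (intro divide_left_mono) auto
    then have "u / \<bar>t\<bar> \<le> u\<^sup>2"
      using \<open>u > 0\<close> mult_left_mono[of "1 / \<bar>t\<bar>" u u] by (simp add: power2_eq_square)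
    also have "u\<^sup>2 \<le> 2 * exp u"
      using exp_lower_Taylor_quadratic[of u] \<open>u > 0\<close> by (simp add: field_simps)
    finally have "u / \<bar>t\<bar> * exp (- u) \<le> 2 * exp u * exp (- u)"
      by (intro mult_right_mono) auto
    also have "2 * exp u * exp (- u) = 2"
      by (simp add: exp_minus)
    finally show ?thesis .
  next
    case t: False
    then have "\<bar>t\<bar> \<ge> 1"
      by simp
    then have "1 \<le> \<bar>t\<bar> ^ (2 * n)"
      by (rule one_le_power)
    then have "u \<le> 1"
      by (simp add: u_def divide_le_eq)
    then have "u / \<bar>t\<bar> \<le> 1 / 1"
      using t \<open>u > 0\<close> by (intro frac_le) auto
    moreover have "exp (- u) \<le> 1"
      using \<open>u > 0\<close> by simp
    ultimately have "u / \<bar>t\<bar> * exp (- u) \<le> 1 * 1"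
      using \<open>u > 0\<close> by (intro mult_mono) auto
    then show ?thesis
      by simp
  qed
  moreover have "\<bar>exp (- (1 / t ^ (2 * n))) * (real (2 * n) * t ^ (2 * n - 1) / (t ^ (2 * n))\<^sup>2)\<bar>
      = 2 * real n * (u / \<bar>t\<bar> * exp (- u))"
  proof -
    have "t ^ (2 * n) = t * t ^ (2 * n - 1)"
      using assms by (simp flip: power_Suc)
    then have "\<bar>t ^ (2 * n - 1) / (t ^ (2 * n))\<^sup>2\<bar> = u / \<bar>t\<bar>"
      using False by (simp add: u_def abs_mult power2_eq_square field_simps flip: power_abs)
    moreover have "exp (- (1 / t ^ (2 * n))) = exp (- u)"
      by (simp add: u_def power_even_abs)
    moreover have "\<bar>exp (- (1 / t ^ (2 * n))) * (real (2 * n) * t ^ (2 * n - 1) / (t ^ (2 * n))\<^sup>2)\<bar>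
        = exp (- (1 / t ^ (2 * n))) * (2 * real n * \<bar>t ^ (2 * n - 1) / (t ^ (2 * n))\<^sup>2\<bar>)"
      by (simp add: abs_mult)
    ultimately show ?thesis
      by (simp only:) simp
  qed
  ultimately have "\<bar>exp (- (1 / t ^ (2 * n))) * (real (2 * n) * t ^ (2 * n - 1) / (t ^ (2 * n))\<^sup>2)\<bar>
      \<le> 4 * real n"
    using mult_left_mono[of "u / \<bar>t\<bar> * exp (- u)" 2 "2 * real n"] by simp
  with der show ?thesis
    using that by blast
qed

lemma g_exp_lipschitz:
  assumes "n \<ge> 1"
  shows "\<bar>g_exp n a - g_exp n b\<bar> \<le> 4 * real n * \<bar>a - b\<bar>"
proof -
  have "\<forall>t. \<exists>d. (g_exp n has_field_derivative d) (at t) \<and> \<bar>d\<bar> \<le> 4 * real n"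
    using g_exp_has_derivative[OF assms] by blast
  then obtain d where d: "\<And>t. (g_exp n has_field_derivative d t) (at t)" "\<And>t. \<bar>d t\<bar> \<le> 4 * real n"
    by metis
  show ?thesis
    using field_differentiable_bound[of UNIV "g_exp n" d "4 * real n" a b] d by simp
qed

text \<open>Source of the radius \<open>1 / (16 * n)\<close> used throughout: multiplied by the
  Lipschitz constant \<open>4 * n\<close> it leaves the factor 1/4, small enough for differences of
  leaf parameters to be absorbed.\<close>

lemma g_exp_leaf_contraction:
  assumes "n \<ge> 1" "cmod z \<le> 1 / (16 * real n)"
  shows "cmod (of_real (g_exp n a - g_exp n b) * z) * 4 \<le> \<bar>a - b\<bar>"
proof -
  have "cmod (of_real (g_exp n a - g_exp n b) * z) \<le> (4 * real n * \<bar>a - b\<bar>) * (1 / (16 * real n))"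
    unfolding norm_mult norm_of_real using g_exp_lipschitz[OF assms(1)] assms(2)
    by (intro mult_mono) auto
  then show ?thesis
    using assms(1) by simp
qed

text \<open>Only the real part of the leaf equation is imposed, so that this parameter is defined and
  continuous also off the hypersurface.\<close>

definition leaf_param :: "nat \<Rightarrow> complex \<Rightarrow> complex \<Rightarrow> real" where
  "leaf_param n z w = (THE t. t + g_exp n t * Re z = Re w)"

text \<open>The parameter is the fixed point of the contraction sending \<open>t\<close> to
  \<open>Re w - g_exp n t * Re z\<close>.\<close>

lemma leaf_param_ex1:
  assumes "n \<ge> 1" "cmod z \<le> 1 / (16 * real n)"
  shows "\<exists>!t. t + g_exp n t * Re z = Re w"
proof -
  have "\<bar>(g_exp n a - g_exp n b) * Re z\<bar> \<le> 1 / 2 * \<bar>a - b\<bar>" for a b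
    using g_exp_leaf_contraction[OF assms, of a b]
      abs_Re_le_cmod[of "of_real (g_exp n a - g_exp n b) * z"] by simp
  then have "dist (Re w - g_exp n a * Re z) (Re w - g_exp n b * Re z) \<le> 1 / 2 * dist a b" for a b
    by (simp add: dist_real_def left_diff_distrib abs_minus_commute)
  then have "\<exists>!t. Re w - g_exp n t * Re z = t"
    by (intro banach_fix_type[of "1 / 2"]) auto
  then show ?thesis
    by (metis add_diff_cancel_right' diff_add_cancel)
qed

lemma leaf_param:
  assumes "n \<ge> 1" "cmod z \<le> 1 / (16 * real n)"
  shows "leaf_param n z w + g_exp n (leaf_param n z w) * Re z = Re w"
  unfolding leaf_param_def by (rule theI'[OF leaf_param_ex1[OF assms]])

lemma leaf_param_eqI:
  assumes "n \<ge> 1" "cmod z \<le> 1 / (16 * real n)" "w = of_real t + of_real (g_exp n t) * z"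
  shows "leaf_param n z w = t"
  using leaf_param_ex1[OF assms(1,2), of w] leaf_param[OF assms(1,2), of w] assms(3) by auto

lemma abs_leaf_param_le:
  assumes "n \<ge> 1" "cmod z \<le> 1 / (16 * real n)"
  shows "\<bar>leaf_param n z w\<bar> \<le> 2 * cmod w"
  using g_exp_leaf_contraction[OF assms, of "leaf_param n z w" 0] leaf_param[OF assms, of w]
    abs_Re_le_cmod[of "of_real (g_exp n (leaf_param n z w)) * z"] abs_Re_le_cmod[of w]
  by simp

lemma leaf_param_lipschitz:
  assumes "n \<ge> 1" "cmod z \<le> 1 / (16 * real n)" "cmod z' \<le> 1 / (16 * real n)"
  shows "\<bar>leaf_param n z w - leaf_param n z' w'\<bar> \<le> 2 * (cmod (w - w') + cmod (z - z'))"
proof -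
  define t t' where "t = leaf_param n z w" and "t' = leaf_param n z' w'"
  have "t + g_exp n t * Re z = Re w" "t' + g_exp n t' * Re z' = Re w'"
    using leaf_param assms by (auto simp: t_def t'_def)
  then have eq: "t - t' = Re (w - w') - Re (of_real (g_exp n t - g_exp n t') * z) - g_exp n t' * Re (z - z')"
    by (simp add: algebra_simps)
  have 1: "\<bar>Re (of_real (g_exp n t - g_exp n t') * z)\<bar> * 4 \<le> \<bar>t - t'\<bar>"
    using g_exp_leaf_contraction[OF assms(1,2), of t t']
      abs_Re_le_cmod[of "of_real (g_exp n t - g_exp n t') * z"] by linarith
  have "\<bar>g_exp n t' * Re (z - z')\<bar> \<le> 1 * cmod (z - z')"
    unfolding abs_mult using g_exp_less_1[of n t'] g_exp_nonneg[of n t']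
    by (intro mult_mono abs_Re_le_cmod) auto
  then have 2: "\<bar>g_exp n t' * Re (z - z')\<bar> \<le> cmod (z - z')"
    by simp
  have "\<bar>x\<bar> \<le> 2 * (A + C)"
    if "x = a - b - c" "\<bar>b\<bar> * 4 \<le> \<bar>x\<bar>" "\<bar>c\<bar> \<le> C" "\<bar>a\<bar> \<le> A" for a b c x A C :: real
    using that by (smt (verit))
  from this[OF eq 1 2 abs_Re_le_cmod] have "\<bar>t - t'\<bar> \<le> 2 * (cmod (w - w') + cmod (z - z'))" .
  then show ?thesis
    by (simp add: t_def t'_def)
qed

section \<open>Complex tangent directions and the leaves\<close>

lemma cone_and_rotated_cone_imp_zero:
  assumes "3 * \<bar>Im z\<bar> \<le> \<bar>Re z\<bar>" "3 * \<bar>Im (\<i> * z)\<bar> \<le> \<bar>Re (\<i> * z)\<bar>"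
  shows "z = 0"
proof -
  have "3 * \<bar>Im z\<bar> \<le> \<bar>Re z\<bar>" "3 * \<bar>Re z\<bar> \<le> \<bar>Im z\<bar>"
    using assms by simp_all
  then have "Re z = 0" "Im z = 0"
    by linarith+
  then show ?thesis
    by (simp add: complex_eq_iff)
qed

text \<open>Along a curve in \<open>M\<close>, the function \<open>f\<close> changes by
  \<open>t - t\<^sub>0\<close> plus an error of modulus at most a quarter of
  \<open>\<bar>t - t\<^sub>0\<bar>\<close>. Hence its real part changes by at least three quarters
  of this length and its imaginary part by at most one quarter; the ratio 3 passes to the limit of
  the difference quotients.\<close>

lemma tangent_space_cone:
  assumes n: "n \<ge> 1"
    and leaf: "\<And>z w. (z, w) \<in> M \<Longrightarrow> cmod z < r \<Longrightarrow> cmod w < r \<Longrightarrow>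
      \<exists>t. w = of_real t + of_real (g_exp n t) * z"
    and q: "w\<^sub>0 = of_real t\<^sub>0 + of_real (g_exp n t\<^sub>0) * z\<^sub>0" "cmod z\<^sub>0 < r" "cmod w\<^sub>0 < r"
      "cmod z\<^sub>0 < 1 / (16 * real n)"
    and v: "v \<in> tangent_space M (z\<^sub>0, w\<^sub>0)"
  defines "\<xi> \<equiv> snd v - of_real (g_exp n t\<^sub>0) * fst v"
  shows "3 * \<bar>Im \<xi>\<bar> \<le> \<bar>Re \<xi>\<bar>"
proof -
  obtain \<gamma> where \<gamma>: "\<gamma> 0 = (z\<^sub>0, w\<^sub>0)" "\<forall>\<^sub>F s in at 0. \<gamma> s \<in> M" "(\<gamma> has_vector_derivative v) (at 0)"
    using v by (auto simp: tangent_space_def)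
  define f where "f s = snd (\<gamma> s) - of_real (g_exp n t\<^sub>0) * fst (\<gamma> s)" for s
  have f: "(f has_vector_derivative \<xi>) (at 0)"
    unfolding f_def[abs_def] \<xi>_def
    using bounded_linear.has_vector_derivative[OF bounded_linear_fst \<gamma>(3)]
      bounded_linear.has_vector_derivative[OF bounded_linear_snd \<gamma>(3)]
    by (intro derivative_intros has_vector_derivative_mult_right) auto
  have "((\<lambda>s. Im (f s)) has_field_derivative Im \<xi>) (at 0)"
    "((\<lambda>s. Re (f s)) has_field_derivative Re \<xi>) (at 0)"
    using bounded_linear.has_vector_derivative[OF bounded_linear_Im f]
      bounded_linear.has_vector_derivative[OF bounded_linear_Re f]
    by (simp_all add: has_real_derivative_iff_has_vector_derivative)
  then have lim: "((\<lambda>s. 3 * \<bar>(Im (f s) - Im (f 0)) / s\<bar>) \<longlongrightarrow> 3 * \<bar>Im \<xi>\<bar>) (at 0)"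
    "((\<lambda>s. \<bar>(Re (f s) - Re (f 0)) / s\<bar>) \<longlongrightarrow> \<bar>Re \<xi>\<bar>) (at 0)"
    unfolding DERIV_def by (auto simp only: add_0 intro!: tendsto_intros)
  have "isCont \<gamma> 0"
    using \<gamma>(3) has_vector_derivative_continuous by blast
  then have "((\<lambda>s. cmod (fst (\<gamma> s))) \<longlongrightarrow> cmod z\<^sub>0) (at 0)" "((\<lambda>s. cmod (snd (\<gamma> s))) \<longlongrightarrow> cmod w\<^sub>0) (at 0)"
    using tendsto_norm[OF tendsto_fst, of \<gamma> "(z\<^sub>0, w\<^sub>0)" "at 0"]
      tendsto_norm[OF tendsto_snd, of \<gamma> "(z\<^sub>0, w\<^sub>0)" "at 0"] \<gamma>(1)
    by (simp_all add: isCont_def)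
  from order_tendstoD(2)[OF this(1) q(2)] order_tendstoD(2)[OF this(1) q(4)]
    order_tendstoD(2)[OF this(2) q(3)]
  have "\<forall>\<^sub>F s in at 0. cmod (fst (\<gamma> s)) < r" "\<forall>\<^sub>F s in at 0. cmod (fst (\<gamma> s)) < 1 / (16 * real n)"
    "\<forall>\<^sub>F s in at 0. cmod (snd (\<gamma> s)) < r" .
  with \<gamma>(2) have "\<forall>\<^sub>F s in at 0. 3 * \<bar>(Im (f s) - Im (f 0)) / s\<bar> \<le> \<bar>(Re (f s) - Re (f 0)) / s\<bar>"
  proof eventually_elim
    case (elim s)
    obtain t where t: "snd (\<gamma> s) = of_real t + of_real (g_exp n t) * fst (\<gamma> s)"
      using leaf[of "fst (\<gamma> s)" "snd (\<gamma> s)"] elim by auto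
    define e where "e = of_real (g_exp n t - g_exp n t\<^sub>0) * fst (\<gamma> s)"
    have "cmod e * 4 \<le> \<bar>t - t\<^sub>0\<bar>"
      unfolding e_def using g_exp_leaf_contraction[OF n] elim(3) by simp
    then have "\<bar>Re e\<bar> * 4 \<le> \<bar>t - t\<^sub>0\<bar>" "\<bar>Im e\<bar> * 4 \<le> \<bar>t - t\<^sub>0\<bar>"
      using abs_Re_le_cmod[of e] abs_Im_le_cmod[of e] by linarith+
    moreover have "f s - f 0 = of_real (t - t\<^sub>0) + e"
      by (simp add: f_def t \<gamma>(1) q(1) e_def algebra_simps)
    then have "Re (f s) - Re (f 0) = t - t\<^sub>0 + Re e" "Im (f s) - Im (f 0) = Im e"
      by (metis minus_complex.sel(1) plus_complex.sel(1) Re_complex_of_real,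
          metis minus_complex.sel(2) plus_complex.sel(2) Im_complex_of_real add_0)
    ultimately have "3 * \<bar>Im (f s) - Im (f 0)\<bar> \<le> \<bar>Re (f s) - Re (f 0)\<bar>"
      by (simp add: abs_if split: if_splits)
    then show ?case
      by (simp add: abs_divide divide_right_mono)
  qed
  then show ?thesis
    using tendsto_le[OF _ lim(2,1)] by simp
qed

text \<open>Both a complex tangent vector and its rotation by a right angle are tangent, so the
  transversal component and its rotation lie in the same narrow cone around the real axis. Only 0
  does.\<close>

lemma complex_tangent_space_leaf:
  assumes n: "n \<ge> 1"
    and leaf: "\<And>z w. (z, w) \<in> M \<Longrightarrow> cmod z < r \<Longrightarrow> cmod w < r \<Longrightarrow>
      \<exists>t. w = of_real t + of_real (g_exp n t) * z"
    and q: "w\<^sub>0 = of_real t\<^sub>0 + of_real (g_exp n t\<^sub>0) * z\<^sub>0" "cmod z\<^sub>0 < r" "cmod w\<^sub>0 < r"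
      "cmod z\<^sub>0 < 1 / (16 * real n)"
    and v: "v \<in> complex_tangent_space M (z\<^sub>0, w\<^sub>0)"
  shows "snd v = of_real (g_exp n t\<^sub>0) * fst v"
proof -
  obtain u where u: "u \<in> tangent_space M (z\<^sub>0, w\<^sub>0)" "v = mult_i u" and "v \<in> tangent_space M (z\<^sub>0, w\<^sub>0)"
    using v by (auto simp: complex_tangent_space_def)
  then have "snd u - of_real (g_exp n t\<^sub>0) * fst u = 0"
    using tangent_space_cone[OF n leaf q, where v = u] tangent_space_cone[OF n leaf q, where v = v]
    by (intro cone_and_rotated_cone_imp_zero) (auto simp: mult_i_def)
  then show ?thesis
    by (simp add: u(2) mult_i_def)
qed

text \<open>With the slope frozen at its value at \<open>x\<close>, the function \<open>f\<close>
  has derivative 0 at \<open>x\<close>, since the velocity points along the leaf. The contraction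
  bound gives \<open>\<bar>\<tau> y - \<tau> x\<bar> \<le> 2 * cmod (f y - f x)\<close>, so
  \<open>\<tau>\<close> is differentiable at \<open>x\<close> with derivative 0 as well.\<close>

lemma leaf_param_constant_along_tangent_curve:
  fixes \<gamma> :: "real \<Rightarrow> C2"
  assumes n: "n \<ge> 1" and "open I" "convex I"
    and on: "\<And>x. x \<in> I \<Longrightarrow> snd (\<gamma> x) = of_real (\<tau> x) + of_real (g_exp n (\<tau> x)) * fst (\<gamma> x)"
    and small: "\<And>x. x \<in> I \<Longrightarrow> cmod (fst (\<gamma> x)) \<le> 1 / (16 * real n)"
    and der: "\<And>x. x \<in> I \<Longrightarrow> (\<gamma> has_vector_derivative v x) (at x)"
    and tan: "\<And>x. x \<in> I \<Longrightarrow> snd (v x) = of_real (g_exp n (\<tau> x)) * fst (v x)"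
    and "a \<in> I" "b \<in> I"
  shows "\<tau> a = \<tau> b"
proof (rule has_derivative_zero_unique[OF \<open>convex I\<close> _ \<open>a \<in> I\<close> \<open>b \<in> I\<close>])
  fix x assume x: "x \<in> I"
  define f where "f y = snd (\<gamma> y) - of_real (g_exp n (\<tau> x)) * fst (\<gamma> y)" for y
  have "(f has_vector_derivative (snd (v x) - of_real (g_exp n (\<tau> x)) * fst (v x))) (at x)"
    unfolding f_def[abs_def]
    using bounded_linear.has_vector_derivative[OF bounded_linear_fst der[OF x]]
      bounded_linear.has_vector_derivative[OF bounded_linear_snd der[OF x]]
    by (intro derivative_intros has_vector_derivative_mult_right) auto
  then have "((\<lambda>y. norm (f y - f x) / norm (y - x)) \<longlongrightarrow> 0) (at x)"
    using tan[OF x] by (simp add: has_vector_derivative_def has_derivative_iff_norm)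
  then have "((\<lambda>y. 2 * (norm (f y - f x) / norm (y - x))) \<longlongrightarrow> 0) (at x)"
    by (rule tendsto_mult_right_zero)
  moreover have "\<forall>\<^sub>F y in at x. norm (norm (\<tau> y - \<tau> x - 0) / norm (y - x))
      \<le> 2 * (norm (f y - f x) / norm (y - x))"
    using eventually_at_in_open'[OF \<open>open I\<close> x]
  proof eventually_elim
    case (elim y)
    define e where "e = of_real (g_exp n (\<tau> y) - g_exp n (\<tau> x)) * fst (\<gamma> y)"
    have "cmod e * 4 \<le> \<bar>\<tau> y - \<tau> x\<bar>"
      unfolding e_def using g_exp_leaf_contraction[OF n] small[OF elim] by simp
    moreover have "f y - f x = of_real (\<tau> y - \<tau> x) + e"
      by (simp add: f_def on[OF x] on[OF elim] e_def algebra_simps)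
    then have "\<bar>\<tau> y - \<tau> x\<bar> \<le> cmod (f y - f x) + cmod e"
      using norm_triangle_ineq4[of "f y - f x" e]
      by (simp flip: of_real_diff)
    ultimately have "\<bar>\<tau> y - \<tau> x\<bar> \<le> 2 * cmod (f y - f x)"
      using norm_ge_zero[of "f y - f x"] by linarith
    then show ?case
      by (simp add: divide_right_mono)
  qed
  ultimately have "((\<lambda>y. norm (\<tau> y - \<tau> x - 0) / norm (y - x)) \<longlongrightarrow> 0) (at x)"
    by (rule Lim_null_comparison[rotated])
  then have "(\<tau> has_derivative (\<lambda>h. 0)) (at x)"
    by (simp add: has_derivative_iff_norm)
  then show "(\<tau> has_derivative (\<lambda>h. 0)) (at x within I)"
    by (rule has_derivative_at_withinI)
qed

subsection \<open>Comparison of two slices\<close>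

text \<open>Transfers flatness between comparable parameters, at the price of a smaller constant in
  the exponent.\<close>

lemma exp_minus_mono_square:
  fixes t s c :: real
  assumes "\<bar>t\<bar> \<le> c * \<bar>s\<bar>" "t \<noteq> 0" "k \<ge> 0"
  shows "exp (- (k / t\<^sup>2)) \<le> exp (- (k / c\<^sup>2) / s\<^sup>2)"
proof -
  have "t\<^sup>2 \<le> c\<^sup>2 * s\<^sup>2"
    using power_mono[OF assms(1), of 2] by (simp add: power_mult_distrib)
  moreover have "t\<^sup>2 > 0"
    using assms(2) by simp
  ultimately have "k / (c\<^sup>2 * s\<^sup>2) \<le> k / t\<^sup>2"
    using assms(3) by (intro divide_left_mono mult_pos_pos) auto
  then show ?thesis
    by simp
qed

text \<open>With \<open>u\<close> the inverse square of \<open>t\<close>, the exponent of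
  \<open>g_exp m \<tau>\<close> is at least \<open>u ^ m / b\<close>. The choice of
  \<open>\<delta>\<close> forces \<open>u \<ge> 1\<close> and \<open>u \<ge> 2 * b\<close>, so this
  exceeds \<open>2 * u ^ n\<close>, hence also \<open>u ^ n + u\<close>. A comparability constant
  between the parameters thus cannot make up for different exponents.\<close>

lemma g_exp_much_smaller:
  assumes "n \<ge> 1" "n < m" "B > 0"
  obtains \<delta> where "\<delta> > 0"
    "\<And>t \<tau>. 0 < \<bar>t\<bar> \<Longrightarrow> \<bar>t\<bar> < \<delta> \<Longrightarrow> \<bar>\<tau>\<bar> \<le> B * \<bar>t\<bar> \<Longrightarrow>
      g_exp m \<tau> \<le> g_exp n t * exp (- (1 / t\<^sup>2))"
proof -
  define b where "b = B ^ (2 * m)"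
  have "b > 0"
    using assms by (simp add: b_def)
  define \<delta> where "\<delta> = min 1 (sqrt (1 / (2 * b)))"
  have "\<delta> > 0"
    using \<open>b > 0\<close> by (simp add: \<delta>_def)
  moreover have "g_exp m \<tau> \<le> g_exp n t * exp (- (1 / t\<^sup>2))"
    if t: "0 < \<bar>t\<bar>" "\<bar>t\<bar> < \<delta>" and \<tau>: "\<bar>\<tau>\<bar> \<le> B * \<bar>t\<bar>" for t \<tau>
  proof (cases "\<tau> = 0")
    case True
    then show ?thesis
      by (simp add: g_exp_nonneg)
  next
    case False
    define u where "u = 1 / t\<^sup>2"
    have "\<bar>t\<bar>\<^sup>2 < (sqrt (1 / (2 * b)))\<^sup>2" "\<bar>t\<bar>\<^sup>2 < 1\<^sup>2"
      using t by (intro power_strict_mono; simp add: \<delta>_def)+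
    then have "t\<^sup>2 < 1 / (2 * b)" "t\<^sup>2 < 1"
      using \<open>b > 0\<close> by simp_all
    then have u: "u \<ge> 1" "u \<ge> 2 * b"
      using t \<open>b > 0\<close> by (auto simp: u_def field_simps)
    have "2 * b * u ^ n \<le> u * u ^ n"
      using u by (intro mult_right_mono) auto
    also have "\<dots> \<le> u ^ m"
      using u assms(2) power_increasing[of "Suc n" m u] by simp
    finally have "2 * u ^ n \<le> u ^ m / b"
      using \<open>b > 0\<close> by (simp add: field_simps)
    also have "u ^ m / b = 1 / (B * \<bar>t\<bar>) ^ (2 * m)"
      by (simp add: u_def b_def power_mult_distrib power_mult power_divide)
    also have "\<dots> \<le> 1 / \<bar>\<tau>\<bar> ^ (2 * m)"
      using \<tau> False t assms by (intro divide_left_mono power_mono) (auto intro!: mult_pos_pos)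
    also have "\<bar>\<tau>\<bar> ^ (2 * m) = \<tau> ^ (2 * m)"
      by (simp add: power_even_abs)
    finally have "2 * u ^ n \<le> 1 / \<tau> ^ (2 * m)" .
    moreover have "u \<le> u ^ n"
      using u assms(1) power_increasing[of 1 n u] by simp
    moreover have "1 / t ^ (2 * n) = u ^ n"
      by (simp add: u_def power_mult power_divide)
    ultimately show ?thesis
      using False t by (simp add: g_exp_def u_def flip: exp_add)
  qed
  ultimately show ?thesis
    by (rule that)
qed

lemma half_disc_mono: "\<rho> \<le> R \<Longrightarrow> half_disc \<rho> \<subseteq> half_disc R"
  by (auto simp: mem_half_disc)

text \<open>With \<open>\<tau>\<close> determined by the real part of the leaf equation,
  \<open>f\<close> is the defect of the imaginary part; it is continuous and has no zero, so it has
  one sign on the connected set. The bounds on \<open>g_exp m\<close> and on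
  \<open>leaf_param\<close> make the correction term at most the square of
  \<open>cmod (h w)\<close>, which is the side condition of the Hopf lemma with constant 1, for
  \<open>h\<close> or for its negative.\<close>

lemma leaf_avoiding_one_sided:
  assumes m: "m \<ge> 1" and "connected A" "continuous_on A a" "continuous_on A h"
    and small: "\<And>w. w \<in> A \<Longrightarrow> cmod (a w) \<le> 1 / (16 * real m)"
    and avoid: "\<And>w t. w \<in> A \<Longrightarrow> h w \<noteq> of_real t + of_real (g_exp m t) * a w"
  shows "(\<forall>w\<in>A. - (cmod (h w))\<^sup>2 < Im (h w)) \<or> (\<forall>w\<in>A. Im (h w) < (cmod (h w))\<^sup>2)"
proof -
  define \<tau> where "\<tau> w = leaf_param m (a w) (h w)" for w
  define f where "f w = Im (h w) - g_exp m (\<tau> w) * Im (a w)" for w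
  have cont_\<tau>: "continuous_on A \<tau>"
    unfolding continuous_on_def
  proof
    fix w assume w: "w \<in> A"
    have "((\<lambda>y. 2 * (cmod (h y - h w) + cmod (a y - a w))) \<longlongrightarrow> 2 * (cmod (h w - h w) + cmod (a w - a w))) (at w within A)"
      using assms(3,4) w by (intro tendsto_intros) (auto simp: continuous_on_def)
    moreover have "\<forall>\<^sub>F y in at w within A. norm (\<tau> y - \<tau> w) \<le> 2 * (cmod (h y - h w) + cmod (a y - a w))"
      unfolding eventually_at_topological
    proof (intro exI[of _ UNIV] conjI ballI impI)
      fix y assume "y \<in> A"
      then show "norm (\<tau> y - \<tau> w) \<le> 2 * (cmod (h y - h w) + cmod (a y - a w))"
        using leaf_param_lipschitz[OF m small small[OF w]] by (simp add: \<tau>_def)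
    qed auto
    ultimately have "((\<lambda>y. \<tau> y - \<tau> w) \<longlongrightarrow> 0) (at w within A)"
      by (intro Lim_null_comparison[of "\<lambda>y. \<tau> y - \<tau> w"
            "\<lambda>y. 2 * (cmod (h y - h w) + cmod (a y - a w))"]) simp_all
    then show "(\<tau> \<longlongrightarrow> \<tau> w) (at w within A)"
      by (rule Lim_null[THEN iffD2])
  qed
  moreover have "continuous_on UNIV (g_exp m)"
  proof (rule continuous_at_imp_continuous_on, rule ballI)
    fix t show "isCont (g_exp m) t"
      using g_exp_has_derivative[OF m, of t] DERIV_isCont by blast
  qed
  ultimately have "continuous_on A (\<lambda>w. g_exp m (\<tau> w))"
    using continuous_on_compose2 by blast
  then have "continuous_on A f"
    unfolding f_def[abs_def] using assms(3,4) by (intro continuous_intros)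
  then have conn: "connected (f ` A)"
    using \<open>connected A\<close> connected_continuous_image by blast
  have "f w \<noteq> 0" if "w \<in> A" for w
  proof
    assume "f w = 0"
    then have "h w = of_real (\<tau> w) + of_real (g_exp m (\<tau> w)) * a w"
      using leaf_param[OF m small[OF that], of "h w"]
      by (simp add: complex_eq_iff f_def \<tau>_def)
    then show False
      using avoid that by blast
  qed
  then have "0 \<notin> f ` A"
    by auto
  have sides: "(\<forall>w\<in>A. f w > 0) \<or> (\<forall>w\<in>A. f w < 0)"
  proof (rule ccontr)
    assume "\<not> ?thesis"
    then obtain v w where "v \<in> A" "w \<in> A" "f v \<le> 0" "0 \<le> f w"
      by force
    then have "0 \<in> f ` A"
      using connectedD_interval[OF conn, of "f v" "f w" 0] by blast
    then show False
      using \<open>0 \<notin> f ` A\<close> by blast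
  qed
  have bound: "\<bar>g_exp m (\<tau> w) * Im (a w)\<bar> \<le> (cmod (h w))\<^sup>2" if "w \<in> A" for w
  proof -
    have "1 / (16 * real m) \<le> 1 / 16"
      using m by (intro divide_left_mono) auto
    then have "\<bar>Im (a w)\<bar> \<le> 1 / 16"
      using abs_Im_le_cmod[of "a w"] small[OF that] by linarith
    then have "g_exp m (\<tau> w) * \<bar>Im (a w)\<bar> \<le> (\<tau> w)\<^sup>2 * (1 / 16)"
      using g_exp_le_square[OF m] g_exp_nonneg by (intro mult_mono) auto
    also have "(\<tau> w)\<^sup>2 \<le> (2 * cmod (h w))\<^sup>2"
      using power_mono[OF abs_leaf_param_le[OF m small[OF that], of "h w"], of 2] by (simp add: \<tau>_def)
    finally have "g_exp m (\<tau> w) * \<bar>Im (a w)\<bar> * 4 \<le> (cmod (h w))\<^sup>2"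
      by (simp add: power_mult_distrib)
    moreover have "0 \<le> g_exp m (\<tau> w) * \<bar>Im (a w)\<bar>"
      by (simp add: g_exp_nonneg)
    ultimately have "g_exp m (\<tau> w) * \<bar>Im (a w)\<bar> \<le> (cmod (h w))\<^sup>2"
      by linarith
    then show ?thesis
      by (simp add: abs_mult g_exp_nonneg)
  qed
  from sides show ?thesis
  proof
    assume "\<forall>w\<in>A. f w > 0"
    then have "- (cmod (h w))\<^sup>2 < Im (h w)" if "w \<in> A" for w
      using abs_le_D2[OF bound[OF that]] bspec[OF \<open>\<forall>w\<in>A. f w > 0\<close> that] unfolding f_def by linarith
    then show ?thesis
      by blast
  next
    assume "\<forall>w\<in>A. f w < 0"
    then have "Im (h w) < (cmod (h w))\<^sup>2" if "w \<in> A" for w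
      using abs_le_D1[OF bound[OF that]] bspec[OF \<open>\<forall>w\<in>A. f w < 0\<close> that] unfolding f_def by linarith
    then show ?thesis
      by blast
  qed
qed

text \<open>Here \<open>(a\<^sub>0, h\<^sub>0)\<close> and \<open>(a\<^sub>1, h\<^sub>1)\<close> are the restrictions of an equivalence to the slices \<open>z = 0\<close>
  and \<open>z = x\<close>, both of which are half discs because \<open>x\<close> is real. The leaf with parameter \<open>t\<close> meets
  the slices in \<open>t\<close> and \<open>t + g_exp n t * x\<close>.\<close>

lemma slices_agree:
  fixes a\<^sub>0 h\<^sub>0 a\<^sub>1 h\<^sub>1 :: "complex \<Rightarrow> complex"
  assumes n: "n \<ge> 1" and m: "m \<ge> 1" and "n \<noteq> m"
    and "R > 0" and x: "0 < x" "x \<le> 1 / (16 * real n)"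
    and hol: "a\<^sub>0 holomorphic_on interior (half_disc R)" "h\<^sub>0 holomorphic_on interior (half_disc R)"
      "a\<^sub>1 holomorphic_on interior (half_disc R)" "h\<^sub>1 holomorphic_on interior (half_disc R)"
    and cont: "continuous_on (half_disc R) a\<^sub>0" "continuous_on (half_disc R) h\<^sub>0"
      "continuous_on (half_disc R) a\<^sub>1" "continuous_on (half_disc R) h\<^sub>1"
    and small: "\<And>w. w \<in> half_disc R \<Longrightarrow> cmod (a\<^sub>0 w) \<le> 1 / (16 * real m)"
      "\<And>w. w \<in> half_disc R \<Longrightarrow> cmod (a\<^sub>1 w) \<le> 1 / (16 * real m)"
    and avoid: "\<And>w t. w \<in> interior (half_disc R) \<Longrightarrow> h\<^sub>0 w \<noteq> of_real t + of_real (g_exp m t) * a\<^sub>0 w"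
    and leaves: "\<And>t. \<bar>t\<bar> \<le> R \<Longrightarrow> \<bar>t + g_exp n t * x\<bar> \<le> R \<Longrightarrow>
      \<exists>\<tau>. h\<^sub>0 (of_real t) = of_real \<tau> + of_real (g_exp m \<tau>) * a\<^sub>0 (of_real t) \<and>
        h\<^sub>1 (of_real (t + g_exp n t * x)) =
          of_real \<tau> + of_real (g_exp m \<tau>) * a\<^sub>1 (of_real (t + g_exp n t * x))"
    and "h\<^sub>0 0 = 0" and "K \<ge> 0"
    and reg_h: "\<And>r s t. \<bar>s\<bar> \<le> r \<Longrightarrow> \<bar>t\<bar> \<le> r \<Longrightarrow> r \<le> R \<Longrightarrow>
      cmod (h\<^sub>0 (of_real t) - h\<^sub>0 (of_real s) - of_real (t - s) * d) \<le> K * r * \<bar>t - s\<bar>"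
    and lip_a: "\<And>s t. \<bar>s\<bar> \<le> R \<Longrightarrow> \<bar>t\<bar> \<le> R \<Longrightarrow>
      cmod (a\<^sub>0 (of_real t) - a\<^sub>0 (of_real s)) \<le> L * \<bar>t - s\<bar>"
  obtains \<rho> where "0 < \<rho>" "\<rho> \<le> R" "\<And>w. w \<in> half_disc \<rho> \<Longrightarrow> h\<^sub>1 w = h\<^sub>0 w"
    "\<And>w. w \<in> half_disc \<rho> \<Longrightarrow> a\<^sub>1 w = a\<^sub>0 w"
proof -
  have real_in: "of_real s \<in> half_disc r" if "\<bar>s\<bar> \<le> r" for s r
    using that by (simp add: mem_half_disc)
  have restrict: "f holomorphic_on interior (half_disc \<rho>)" "continuous_on (half_disc \<rho>) g"
    if "\<rho> \<le> R" "f holomorphic_on interior (half_disc R)" "continuous_on (half_disc R) g" for f g \<rho>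
    using that half_disc_mono[of \<rho> R] interior_mono[OF half_disc_mono[of \<rho> R]]
      holomorphic_on_subset continuous_on_subset by blast+
  have inv16: "1 / (16 * real m) \<le> 1 / 2" "1 / (16 * real n) \<le> 1"
    using n m by (auto simp: divide_le_eq)

  \<comment> \<open>If the boundary derivative were 0, then \<open>reg_h\<close> with
    \<open>s = 0\<close> and \<open>r = \<bar>t\<bar>\<close> would make \<open>h\<^sub>0\<close>
    quadratically small on the diameter, against the Hopf lemma.\<close>
  have "d \<noteq> 0"
  proof
    assume "d = 0"
    have quad: "cmod (h\<^sub>0 (of_real s)) \<le> K * s\<^sup>2" if "\<bar>s\<bar> \<le> R" for s
      using reg_h[of 0 "\<bar>s\<bar>" s] that \<open>d = 0\<close> \<open>h\<^sub>0 0 = 0\<close>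
      by (simp add: mult.assoc power2_eq_square)
    have "continuous_on (interior (half_disc R)) a\<^sub>0" "continuous_on (interior (half_disc R)) h\<^sub>0"
      using hol holomorphic_on_imp_continuous_on by auto
    moreover have "cmod (a\<^sub>0 w) \<le> 1 / (16 * real m)" if "w \<in> interior (half_disc R)" for w
      using small(1) that interior_subset by blast
    ultimately have "(\<forall>w\<in>interior (half_disc R). - (cmod (h\<^sub>0 w))\<^sup>2 < Im (h\<^sub>0 w)) \<or>
        (\<forall>w\<in>interior (half_disc R). Im (h\<^sub>0 w) < (cmod (h\<^sub>0 w))\<^sup>2)"
      by (intro leaf_avoiding_one_sided[OF m connected_interior_half_disc, of R a\<^sub>0 h\<^sub>0] avoid)
    then consider "\<forall>w\<in>interior (half_disc R). - (cmod (h\<^sub>0 w))\<^sup>2 < Im (h\<^sub>0 w)"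
      | "\<forall>w\<in>interior (half_disc R). Im (h\<^sub>0 w) < (cmod (h\<^sub>0 w))\<^sup>2"
      by blast
    then show False
    proof cases
      case 1
      then show False
        using hopf_not_quadratic[OF hol(2) cont(2) \<open>R > 0\<close>, of 1 K] quad by simp
    next
      case 2
      then show False
        using hopf_not_quadratic[OF holomorphic_on_minus[OF hol(2)] continuous_on_minus[OF cont(2)]
            \<open>R > 0\<close>, of 1 K] quad by simp
    qed
  qed
  \<comment> \<open>Upper comparability constant: \<open>\<bar>\<tau>\<bar> \<le> 2 * cmod
    (h\<^sub>0 t) \<le> 3 * cmod d * \<bar>t\<bar>\<close>. The maximum with 1 lets a single
    flatness constant, the inverse square of \<open>2 * B\<close>, serve for both \<open>t\<close>
    and \<open>\<tau>\<close>.\<close>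
  define B where "B = max 1 (3 * cmod d)"
  have B: "B \<ge> 1" "3 * cmod d \<le> B"
    by (auto simp: B_def)
  \<comment> \<open>The second entry ensures \<open>\<bar>\<tau>\<bar> \<le> 1\<close>. The third
    makes the deviation from linearity at most half of the linear part, so that
    \<open>h\<^sub>0\<close> is bi-Lipschitz on the diameter with constants 1/2 and 3/2 times
    \<open>cmod d\<close>.\<close>
  define r where "r = Min {R, 1 / B, cmod d / (2 * (K + 1))}"
  have "r > 0"
    using \<open>R > 0\<close> B(1) \<open>d \<noteq> 0\<close> \<open>K \<ge> 0\<close> by (simp add: r_def)
  have r: "r \<le> R" "r \<le> 1 / B" "r \<le> cmod d / (2 * (K + 1))"
    by (auto simp: r_def)
  have Kr: "K * r \<le> cmod d / 2"
  proof -
    have "K * r \<le> (K + 1) * r"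
      using \<open>r > 0\<close> by (simp add: mult_right_mono)
    also have "\<dots> \<le> (K + 1) * (cmod d / (2 * (K + 1)))"
      using r(3) \<open>K \<ge> 0\<close> by (intro mult_left_mono) auto
    also have "\<dots> = cmod d / 2"
      using \<open>K \<ge> 0\<close> by (simp add: field_simps)
    finally show ?thesis .
  qed
  have "r \<le> 1"
    using order_trans[OF r(2), of 1] B(1) by simp
  have dh: "cmod (h\<^sub>0 (of_real t) - h\<^sub>0 (of_real s) - of_real (t - s) * d) \<le> cmod d / 2 * \<bar>t - s\<bar>"
    if "\<bar>s\<bar> \<le> r" "\<bar>t\<bar> \<le> r" for s t
    using order_trans[OF reg_h[OF that r(1)] mult_right_mono[OF Kr]] by simp
  have norm_d: "cmod (of_real (t - s) * d) = cmod d * \<bar>t - s\<bar>" for s t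
    by (simp only: norm_mult norm_of_real mult.commute)
  have dh_upper: "cmod (h\<^sub>0 (of_real t) - h\<^sub>0 (of_real s)) \<le> 3 / 2 * cmod d * \<bar>t - s\<bar>"
    if "\<bar>s\<bar> \<le> r" "\<bar>t\<bar> \<le> r" for s t
    using dh[OF that] norm_d[of t s]
      norm_triangle_ineq2[of "h\<^sub>0 (of_real t) - h\<^sub>0 (of_real s)" "of_real (t - s) * d"] by linarith
  have dh_lower: "cmod d / 2 * \<bar>t - s\<bar> \<le> cmod (h\<^sub>0 (of_real t) - h\<^sub>0 (of_real s))"
    if "\<bar>s\<bar> \<le> r" "\<bar>t\<bar> \<le> r" for s t
    using dh[OF that] norm_d[of t s]
      norm_triangle_ineq3[of "of_real (t - s) * d" "h\<^sub>0 (of_real t) - h\<^sub>0 (of_real s)"]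
      norm_minus_commute[of "of_real (t - s) * d" "h\<^sub>0 (of_real t) - h\<^sub>0 (of_real s)"] by linarith
  \<comment> \<open>The correspondence between the leaf parameters distorts sizes by bounded factors
    in both directions.\<close>
  have param: "cmod d / 4 * \<bar>t\<bar> \<le> \<bar>\<tau>\<bar>" "\<bar>\<tau>\<bar> \<le> B * \<bar>t\<bar>"
    if "\<bar>t\<bar> \<le> r" and eq: "h\<^sub>0 (of_real t) = of_real \<tau> + of_real (g_exp m \<tau>) * a\<^sub>0 (of_real t)" for t \<tau>
  proof -
    have sm: "cmod (a\<^sub>0 (of_real t)) \<le> 1 / (16 * real m)"
      using that r by (intro small real_in) auto
    have "\<bar>\<tau>\<bar> \<le> 2 * cmod (h\<^sub>0 (of_real t))"
      using abs_leaf_param_le[OF m sm] leaf_param_eqI[OF m sm eq] by metis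
    also have "\<dots> \<le> 3 * cmod d * \<bar>t\<bar>"
      using dh_upper[of 0 t] that \<open>h\<^sub>0 0 = 0\<close> \<open>r > 0\<close> by simp
    also have "\<dots> \<le> B * \<bar>t\<bar>"
      using B by (intro mult_right_mono) auto
    finally show "\<bar>\<tau>\<bar> \<le> B * \<bar>t\<bar>" .
    have "cmod d / 2 * \<bar>t\<bar> \<le> cmod (h\<^sub>0 (of_real t))"
      using dh_lower[of 0 t] that \<open>h\<^sub>0 0 = 0\<close> \<open>r > 0\<close> by simp
    also have "\<dots> \<le> \<bar>\<tau>\<bar> + cmod (of_real (g_exp m \<tau>) * a\<^sub>0 (of_real t))"
      unfolding eq by (rule order_trans[OF norm_triangle_ineq]) simp
    also have "\<dots> \<le> 2 * \<bar>\<tau>\<bar>"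
      using g_exp_leaf_contraction[OF m sm, of \<tau> 0] by simp
    finally show "cmod d / 4 * \<bar>t\<bar> \<le> \<bar>\<tau>\<bar>"
      by simp
  qed
  define \<rho> where "\<rho> = r / 2"
  have "\<rho> > 0" "\<rho> \<le> R" "\<rho> \<le> r"
    using \<open>r > 0\<close> r(1) by (auto simp: \<rho>_def)
  \<comment> \<open>Every boundary point of the slice at \<open>x\<close> lies on a leaf, whose
    parameter satisfies \<open>\<bar>t\<bar> \<le> 2 * \<bar>s\<bar>\<close>; halving
    \<open>r\<close> keeps \<open>t\<close> in range.\<close>
  have boundary: "\<exists>t \<tau>. s = t + g_exp n t * x \<and> \<bar>t\<bar> \<le> 2 * \<bar>s\<bar> \<and> \<bar>t\<bar> \<le> r \<and> t \<noteq> 0 \<and>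
      h\<^sub>0 (of_real t) = of_real \<tau> + of_real (g_exp m \<tau>) * a\<^sub>0 (of_real t) \<and>
      h\<^sub>1 (of_real s) = of_real \<tau> + of_real (g_exp m \<tau>) * a\<^sub>1 (of_real s)"
    if s: "\<bar>s\<bar> \<le> \<rho>" "s \<noteq> 0" for s
  proof -
    define t where "t = leaf_param n (of_real x) (of_real s)"
    have xn: "cmod (of_real x) \<le> 1 / (16 * real n)"
      using x by simp
    have t: "t + g_exp n t * x = s" "\<bar>t\<bar> \<le> 2 * \<bar>s\<bar>"
      using leaf_param[OF n xn, of "of_real s"] abs_leaf_param_le[OF n xn, of "of_real s"]
      by (auto simp: t_def)
    then have "t \<noteq> 0"
      using s by auto
    have "\<bar>t\<bar> \<le> r"
      using t(2) s(1) by (simp add: \<rho>_def)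
    moreover from this have "\<bar>t\<bar> \<le> R" "\<bar>s\<bar> \<le> R"
      using r(1) s(1) \<open>\<rho> \<le> R\<close> by auto
    ultimately show ?thesis
      using leaves[of t] t \<open>t \<noteq> 0\<close> by metis
  qed
  have a_diff: "cmod (a\<^sub>1 (of_real s) - a\<^sub>0 (of_real t)) \<le> 1" if "\<bar>s\<bar> \<le> R" "\<bar>t\<bar> \<le> R" for s t
    using norm_triangle_ineq4[of "a\<^sub>1 (of_real s)" "a\<^sub>0 (of_real t)"]
      small(2)[OF real_in[OF that(1)]] small(1)[OF real_in[OF that(2)]] inv16 by linarith
  have gx: "g_exp n t * x \<le> g_exp n t" for t
    using x inv16 g_exp_nonneg[of n t] by (intro mult_left_le) auto
  have g_flat: "g_exp n t \<le> exp (- (1 / (2 * B)\<^sup>2) / s\<^sup>2)"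
    if "\<bar>t\<bar> \<le> 2 * \<bar>s\<bar>" "\<bar>t\<bar> \<le> r" "t \<noteq> 0" for s t
  proof -
    have "2 * \<bar>s\<bar> \<le> 2 * B * \<bar>s\<bar>"
      using B(1) by (intro mult_right_mono) auto
    then show ?thesis
      using order_trans[OF g_exp_le_exp[OF n, of t] exp_minus_mono_square[of t "2 * B" s 1]] that \<open>r \<le> 1\<close>
      by auto
  qed
  have Bt: "\<bar>\<tau>\<bar> \<le> 2 * B * \<bar>s\<bar>" if "\<bar>\<tau>\<bar> \<le> B * \<bar>t\<bar>" "\<bar>t\<bar> \<le> 2 * \<bar>s\<bar>" for \<tau> s t
    using order_trans[OF that(1) mult_left_mono[OF that(2), of B]] B(1) by (simp add: ac_simps)
  have h_eq: "h\<^sub>1 w = h\<^sub>0 w" if "w \<in> half_disc \<rho>" for w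
  proof -
    have "h\<^sub>1 w - h\<^sub>0 w = 0"
    proof (rule half_disc_flat_imp_zero[OF _ _ \<open>\<rho> > 0\<close> _ _ that])
      show "(\<lambda>w. h\<^sub>1 w - h\<^sub>0 w) holomorphic_on interior (half_disc \<rho>)"
        "continuous_on (half_disc \<rho>) (\<lambda>w. h\<^sub>1 w - h\<^sub>0 w)"
        using restrict[OF \<open>\<rho> \<le> R\<close> hol(2) cont(2)] restrict[OF \<open>\<rho> \<le> R\<close> hol(4) cont(4)]
        by (auto intro!: holomorphic_intros continuous_intros)
      show "1 / (2 * B)\<^sup>2 > 0"
        using B(1) by simp
      fix s :: real assume s: "\<bar>s\<bar> \<le> \<rho>" "s \<noteq> 0"
      obtain t \<tau> where t: "s = t + g_exp n t * x" "\<bar>t\<bar> \<le> 2 * \<bar>s\<bar>" "\<bar>t\<bar> \<le> r" "t \<noteq> 0"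
        and \<tau>: "h\<^sub>0 (of_real t) = of_real \<tau> + of_real (g_exp m \<tau>) * a\<^sub>0 (of_real t)"
          "h\<^sub>1 (of_real s) = of_real \<tau> + of_real (g_exp m \<tau>) * a\<^sub>1 (of_real s)"
        using boundary[OF s] by blast
      have \<tau>B: "\<bar>\<tau>\<bar> \<le> B * \<bar>t\<bar>"
        by (rule param(2)[OF t(3) \<tau>(1)])
      also have "\<dots> \<le> B * (1 / B)"
        using t(3) r(2) B(1) by (intro mult_left_mono) auto
      finally have "\<bar>\<tau>\<bar> \<le> 1"
        using B(1) by simp
      have g\<tau>: "g_exp m \<tau> \<le> exp (- (1 / (2 * B)\<^sup>2) / s\<^sup>2)"
      proof (cases "\<tau> = 0")
        case False
        then show ?thesis
          using order_trans[OF g_exp_le_exp[OF m \<open>\<bar>\<tau>\<bar> \<le> 1\<close>] exp_minus_mono_square[of \<tau> "2 * B" s 1]]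
            Bt[OF \<tau>B t(2)] by simp
      qed simp
      \<comment> \<open>Both terms on the right are flat: the first contains
        \<open>g_exp m \<tau>\<close>, and the second is controlled by
        \<open>\<bar>t - s\<bar> = g_exp n t * x\<close>.\<close>
      have "h\<^sub>1 (of_real s) - h\<^sub>0 (of_real s) =
          of_real (g_exp m \<tau>) * (a\<^sub>1 (of_real s) - a\<^sub>0 (of_real t)) + (h\<^sub>0 (of_real t) - h\<^sub>0 (of_real s))"
        by (simp add: \<tau> algebra_simps)
      then have "cmod (h\<^sub>1 (of_real s) - h\<^sub>0 (of_real s)) \<le>
          g_exp m \<tau> * cmod (a\<^sub>1 (of_real s) - a\<^sub>0 (of_real t)) + cmod (h\<^sub>0 (of_real t) - h\<^sub>0 (of_real s))"
        by (simp only:) (rule order_trans[OF norm_triangle_ineq], simp add: norm_mult g_exp_nonneg)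
      also have "\<dots> \<le> g_exp m \<tau> * 1 + 3 / 2 * cmod d * \<bar>t - s\<bar>"
        using s t r(1) \<open>\<rho> \<le> R\<close> \<open>\<rho> \<le> r\<close>
        by (intro add_mono mult_left_mono a_diff dh_upper g_exp_nonneg) auto
      also have "\<bar>t - s\<bar> = g_exp n t * x"
        using t(1) x g_exp_nonneg[of n t] by simp
      also have "g_exp m \<tau> * 1 + 3 / 2 * cmod d * (g_exp n t * x) \<le>
          exp (- (1 / (2 * B)\<^sup>2) / s\<^sup>2) + 3 / 2 * cmod d * exp (- (1 / (2 * B)\<^sup>2) / s\<^sup>2)"
        using g\<tau> order_trans[OF gx g_flat[OF t(2-4)]] by (intro add_mono mult_left_mono) auto
      finally show "cmod (h\<^sub>1 (of_real s) - h\<^sub>0 (of_real s)) \<le>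
          (1 + 3 / 2 * cmod d) * exp (- (1 / (2 * B)\<^sup>2) / s\<^sup>2)"
        by (simp add: algebra_simps)
    qed
    then show ?thesis
      by simp
  qed
  \<comment> \<open>Once \<open>h\<^sub>1 = h\<^sub>0\<close> is known, the two leaf equations
    balance exactly. The right side is comparable to \<open>\<bar>s - t\<bar>\<close>, that is, to
    \<open>g_exp n t\<close>.\<close>
  have key: "g_exp m \<tau> * cmod (a\<^sub>1 (of_real s) - a\<^sub>0 (of_real t)) = cmod (h\<^sub>0 (of_real s) - h\<^sub>0 (of_real t))"
    if "h\<^sub>0 (of_real t) = of_real \<tau> + of_real (g_exp m \<tau>) * a\<^sub>0 (of_real t)"
      "h\<^sub>1 (of_real s) = of_real \<tau> + of_real (g_exp m \<tau>) * a\<^sub>1 (of_real s)" "\<bar>s\<bar> \<le> \<rho>" for s t \<tau>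
  proof -
    have "of_real (g_exp m \<tau>) * (a\<^sub>1 (of_real s) - a\<^sub>0 (of_real t)) = h\<^sub>1 (of_real s) - h\<^sub>0 (of_real t)"
      by (simp add: that algebra_simps)
    also have "h\<^sub>1 (of_real s) = h\<^sub>0 (of_real s)"
      using that by (intro h_eq real_in)
    finally show ?thesis
      by (metis norm_mult norm_of_real abs_of_nonneg g_exp_nonneg)
  qed
  show ?thesis
  proof (cases "n < m")
    \<comment> \<open>Here \<open>g_exp m \<tau>\<close> is far smaller than
      \<open>g_exp n t\<close> while the difference of the first components is bounded, so
      \<open>key\<close> fails at one sufficiently small \<open>s\<close>.\<close>
    case True
    obtain \<delta> where \<delta>: "\<delta> > 0" "\<And>t \<tau>. 0 < \<bar>t\<bar> \<Longrightarrow> \<bar>t\<bar> < \<delta> \<Longrightarrow> \<bar>\<tau>\<bar> \<le> B * \<bar>t\<bar> \<Longrightarrow>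
      g_exp m \<tau> \<le> g_exp n t * exp (- (1 / t\<^sup>2))"
      using g_exp_much_smaller[OF n True, of B] B(1) by auto
    define \<kappa> where "\<kappa> = cmod d / 2 * x"
    have "\<kappa> > 0"
      using \<open>d \<noteq> 0\<close> x by (simp add: \<kappa>_def)
    \<comment> \<open>The last entry yields that the square of \<open>t\<close> is at most
      \<open>4 / 5 * \<kappa>\<close>, below the lower bound \<open>\<kappa>\<close> derived for
      it.\<close>
    define s where "s = min \<rho> (min (\<delta> / 3) (sqrt (\<kappa> / 5)))"
    have s: "\<bar>s\<bar> \<le> \<rho>" "s \<noteq> 0" "\<bar>s\<bar> \<le> \<delta> / 3" "\<bar>s\<bar> \<le> sqrt (\<kappa> / 5)"
      using \<open>\<rho> > 0\<close> \<delta>(1) \<open>\<kappa> > 0\<close> by (auto simp: s_def min_def)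
    obtain t \<tau> where t: "s = t + g_exp n t * x" "\<bar>t\<bar> \<le> 2 * \<bar>s\<bar>" "\<bar>t\<bar> \<le> r" "t \<noteq> 0"
      and \<tau>: "h\<^sub>0 (of_real t) = of_real \<tau> + of_real (g_exp m \<tau>) * a\<^sub>0 (of_real t)"
        "h\<^sub>1 (of_real s) = of_real \<tau> + of_real (g_exp m \<tau>) * a\<^sub>1 (of_real s)"
      using boundary[OF s(1,2)] by blast
    have "\<kappa> * g_exp n t = cmod d / 2 * \<bar>s - t\<bar>"
      using t(1) x g_exp_nonneg[of n t] by (simp add: \<kappa>_def)
    also have "\<dots> \<le> g_exp m \<tau> * cmod (a\<^sub>1 (of_real s) - a\<^sub>0 (of_real t))"
      unfolding key[OF \<tau> s(1)] using t s(1) \<open>\<rho> \<le> r\<close> by (intro dh_lower) auto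
    also have "\<dots> \<le> g_exp m \<tau> * 1"
      using s(1) t(3) r(1) \<open>\<rho> \<le> R\<close> by (intro mult_left_mono a_diff g_exp_nonneg) auto
    also have "\<dots> \<le> g_exp n t * exp (- (1 / t\<^sup>2))"
      using \<delta>(2)[of t \<tau>] param(2)[OF t(3) \<tau>(1)] t(2,4) s(3) \<delta>(1) by simp
    finally have "\<kappa> \<le> exp (- (1 / t\<^sup>2))"
      using t(4) by (simp add: g_exp_def)
    also have "\<dots> \<le> t\<^sup>2"
      using t(4) by (intro exp_minus_inverse_le) simp
    also have "\<dots> \<le> (2 * sqrt (\<kappa> / 5))\<^sup>2"
      using t(2) s(4) \<open>\<kappa> > 0\<close> by (intro power2_le_iff_abs_le[THEN iffD2]) auto
    also have "\<dots> = 4 / 5 * \<kappa>"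
      using \<open>\<kappa> > 0\<close> by (simp add: power_mult_distrib)
    finally show ?thesis
      using \<open>\<kappa> > 0\<close> by simp
  next
    case False
    then have "m < n"
      using \<open>n \<noteq> m\<close> by simp
    \<comment> \<open>The comparison is used with the roles exchanged, through the lower bound for
      \<open>\<bar>\<tau>\<bar>\<close>: now \<open>g_exp n t\<close> is negligible against
      \<open>g_exp m \<tau>\<close>.\<close>
    obtain \<delta> where \<delta>: "\<delta> > 0" "\<And>\<tau> t. 0 < \<bar>\<tau>\<bar> \<Longrightarrow> \<bar>\<tau>\<bar> < \<delta> \<Longrightarrow> \<bar>t\<bar> \<le> 4 / cmod d * \<bar>\<tau>\<bar> \<Longrightarrow>
      g_exp n t \<le> g_exp m \<tau> * exp (- (1 / \<tau>\<^sup>2))"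
      using g_exp_much_smaller[OF m \<open>m < n\<close>, of "4 / cmod d"] \<open>d \<noteq> 0\<close> by auto
    define \<sigma> where "\<sigma> = min \<rho> (\<delta> / (3 * B))"
    have \<sigma>: "\<sigma> > 0" "\<sigma> \<le> \<rho>" "\<sigma> \<le> R" "\<sigma> \<le> \<delta> / (3 * B)"
      using \<open>\<rho> > 0\<close> \<open>\<rho> \<le> R\<close> \<delta>(1) B(1) by (auto simp: \<sigma>_def)
    have "L \<ge> 0"
      using lip_a[of 0 R] \<open>R > 0\<close> order_trans[OF norm_ge_zero lip_a[of 0 R]]
      by (simp add: zero_le_mult_iff)
    have a_eq: "a\<^sub>1 w = a\<^sub>0 w" if "w \<in> half_disc \<sigma>" for w
    proof -
      have "a\<^sub>1 w - a\<^sub>0 w = 0"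
      proof (rule half_disc_flat_imp_zero[OF _ _ \<open>\<sigma> > 0\<close> _ _ that])
        show "(\<lambda>w. a\<^sub>1 w - a\<^sub>0 w) holomorphic_on interior (half_disc \<sigma>)"
          "continuous_on (half_disc \<sigma>) (\<lambda>w. a\<^sub>1 w - a\<^sub>0 w)"
          using restrict[OF \<open>\<sigma> \<le> R\<close> hol(1) cont(1)] restrict[OF \<open>\<sigma> \<le> R\<close> hol(3) cont(3)]
          by (auto intro!: holomorphic_intros continuous_intros)
        show "1 / (2 * B)\<^sup>2 > 0"
          using B(1) by simp
        fix s :: real assume s': "\<bar>s\<bar> \<le> \<sigma>" "s \<noteq> 0"
        then have s: "\<bar>s\<bar> \<le> \<rho>" "s \<noteq> 0"
          using \<sigma> by auto
        obtain t \<tau> where t: "s = t + g_exp n t * x" "\<bar>t\<bar> \<le> 2 * \<bar>s\<bar>" "\<bar>t\<bar> \<le> r" "t \<noteq> 0"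
          and \<tau>: "h\<^sub>0 (of_real t) = of_real \<tau> + of_real (g_exp m \<tau>) * a\<^sub>0 (of_real t)"
            "h\<^sub>1 (of_real s) = of_real \<tau> + of_real (g_exp m \<tau>) * a\<^sub>1 (of_real s)"
          using boundary[OF s] by blast
        have \<tau>B: "\<bar>\<tau>\<bar> \<le> B * \<bar>t\<bar>" and \<tau>A: "cmod d / 4 * \<bar>t\<bar> \<le> \<bar>\<tau>\<bar>"
          by (rule param[OF t(3) \<tau>(1)])+
        have "\<bar>\<tau>\<bar> > 0"
          using \<tau>A t(4) \<open>d \<noteq> 0\<close> by (auto simp: mult_le_0_iff)
        have dist: "\<bar>s - t\<bar> = g_exp n t * x"
          using t(1) x g_exp_nonneg[of n t] by simp
        have "\<bar>\<tau>\<bar> \<le> 2 * B * \<bar>s\<bar>"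
          by (rule Bt[OF \<tau>B t(2)])
        also have "\<dots> \<le> 2 * B * (\<delta> / (3 * B))"
          using s'(1) \<sigma>(4) B(1) by (intro mult_left_mono) auto
        also have "\<dots> < \<delta>"
          using B(1) \<delta>(1) by simp
        finally have "g_exp n t \<le> g_exp m \<tau> * exp (- (1 / \<tau>\<^sup>2))"
          using \<delta>(2)[of \<tau> t] \<open>\<bar>\<tau>\<bar> > 0\<close> \<tau>A \<open>d \<noteq> 0\<close> by (simp add: field_simps)
        also have "\<dots> \<le> g_exp m \<tau> * exp (- (1 / (2 * B)\<^sup>2) / s\<^sup>2)"
          using exp_minus_mono_square[OF Bt[OF \<tau>B t(2)], of 1] \<open>\<bar>\<tau>\<bar> > 0\<close>
          by (intro mult_left_mono g_exp_nonneg) auto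
        finally have g: "g_exp n t \<le> g_exp m \<tau> * exp (- (1 / (2 * B)\<^sup>2) / s\<^sup>2)" .
        have "g_exp m \<tau> * cmod (a\<^sub>1 (of_real s) - a\<^sub>0 (of_real t)) \<le> 3 / 2 * cmod d * \<bar>s - t\<bar>"
          unfolding key[OF \<tau> s(1)] using t s(1) \<open>\<rho> \<le> r\<close> by (intro dh_upper) auto
        also have "\<dots> \<le> 3 / 2 * cmod d * (g_exp m \<tau> * exp (- (1 / (2 * B)\<^sup>2) / s\<^sup>2))"
          unfolding dist by (intro mult_left_mono order_trans[OF gx g]) auto
        also have "\<dots> = g_exp m \<tau> * (3 / 2 * cmod d * exp (- (1 / (2 * B)\<^sup>2) / s\<^sup>2))"
          by simp
        \<comment> \<open>The factor \<open>g_exp m \<tau>\<close> cancels because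
          \<open>\<tau> \<noteq> 0\<close>, which comes from the lower comparability bound.\<close>
        finally have 1: "cmod (a\<^sub>1 (of_real s) - a\<^sub>0 (of_real t)) \<le> 3 / 2 * cmod d * exp (- (1 / (2 * B)\<^sup>2) / s\<^sup>2)"
          by (rule mult_left_le_imp_le) (use \<open>\<bar>\<tau>\<bar> > 0\<close> in \<open>simp add: g_exp_def\<close>)
        \<comment> \<open>The first components were compared at the different points
          \<open>s\<close> and \<open>t\<close>; the Lipschitz bound brings both to \<open>s\<close>
          with a flat error.\<close>
        have "cmod (a\<^sub>0 (of_real t) - a\<^sub>0 (of_real s)) \<le> L * \<bar>t - s\<bar>"
          using s(1) t(3) r(1) \<open>\<rho> \<le> R\<close> by (intro lip_a) auto
        also have "\<bar>t - s\<bar> \<le> exp (- (1 / (2 * B)\<^sup>2) / s\<^sup>2)"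
          using order_trans[OF gx g_flat[OF t(2-4)]] dist by (simp add: abs_minus_commute)
        finally have 2: "cmod (a\<^sub>0 (of_real t) - a\<^sub>0 (of_real s)) \<le> L * exp (- (1 / (2 * B)\<^sup>2) / s\<^sup>2)"
          using \<open>L \<ge> 0\<close> by (simp add: mult_left_mono)
        show "cmod (a\<^sub>1 (of_real s) - a\<^sub>0 (of_real s)) \<le>
            (3 / 2 * cmod d + L) * exp (- (1 / (2 * B)\<^sup>2) / s\<^sup>2)"
          using norm_triangle_ineq[of "a\<^sub>1 (of_real s) - a\<^sub>0 (of_real t)" "a\<^sub>0 (of_real t) - a\<^sub>0 (of_real s)"]
            1 2 by (simp add: algebra_simps)
      qed
      then show ?thesis
        by simp
    qed
    show ?thesis
      using that[OF \<sigma>(1,3) _ a_eq] h_eq half_disc_mono[OF \<sigma>(2)] by blast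
  qed
qed

subsection \<open>Smooth CR maps and holomorphic maps\<close>

lemma smooth_on_has_derivative:
  assumes "smooth_on W G" "x \<in> W"
  shows "(G has_derivative frechet_derivative G (at x)) (at x)"
proof -
  have "Ck_on (Suc 0) W G"
    using assms(1) by (simp add: smooth_on_def del: Ck_on.simps)
  then show ?thesis
    using assms(2) frechet_derivative_works by auto
qed

text \<open>The directional derivative \<open>F\<close> is itself differentiable at 0, so it differs
  from \<open>d = F 0\<close> by at most \<open>K * r\<close> on the segment of radius
  \<open>r\<close>; the mean value inequality integrates this. The quantity needed is the second
  order bound relative to \<open>\<bar>t - s\<bar>\<close>, uniform in both end points.\<close>

lemma smooth_on_line_quadratic_bound:
  fixes G :: "'a::euclidean_space \<Rightarrow> 'b::euclidean_space"
  assumes "smooth_on W G" "0 \<in> W"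
  obtains \<delta> K d where "\<delta> > 0" "K \<ge> 0"
    "\<And>r s t. \<bar>s\<bar> \<le> r \<Longrightarrow> \<bar>t\<bar> \<le> r \<Longrightarrow> r \<le> \<delta> \<Longrightarrow>
      norm (G (t *\<^sub>R u) - G (s *\<^sub>R u) - (t - s) *\<^sub>R d) \<le> K * r * \<bar>t - s\<bar>"
proof -
  define F where "F x = frechet_derivative G (at x) u" for x
  have "open W"
    using assms(1) by (simp add: smooth_on_def)
  then obtain e where e: "e > 0" "ball 0 e \<subseteq> W"
    using assms(2) open_contains_ball by metis
  define \<delta>\<^sub>1 where "\<delta>\<^sub>1 = e / (norm u + 1)"
  have "\<delta>\<^sub>1 > 0"
    using e by (simp add: \<delta>\<^sub>1_def add_nonneg_pos)
  have inW: "t *\<^sub>R u \<in> W" if "\<bar>t\<bar> < \<delta>\<^sub>1" for t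
  proof -
    have "\<bar>t\<bar> * norm u \<le> \<bar>t\<bar> * (norm u + 1)"
      by (simp add: mult_left_mono)
    also have "\<dots> < e"
      using that by (simp add: \<delta>\<^sub>1_def less_divide_eq add_nonneg_pos)
    finally show ?thesis
      using e(2) by auto
  qed
  have der: "((\<lambda>t. G (t *\<^sub>R u)) has_vector_derivative F (t *\<^sub>R u)) (at t within X)" if "\<bar>t\<bar> < \<delta>\<^sub>1" for t X
  proof -
    have 1: "((\<lambda>t. t *\<^sub>R u) has_vector_derivative u) (at t within X)"
      by (auto intro!: derivative_eq_intros)
    have "(G has_derivative frechet_derivative G (at (t *\<^sub>R u))) (at (t *\<^sub>R u) within (\<lambda>t. t *\<^sub>R u) ` X)"
      using smooth_on_has_derivative[OF assms(1) inW[OF that]] has_derivative_at_withinI by blast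
    from vector_derivative_diff_chain_within[OF 1 this] show ?thesis
      by (simp add: o_def F_def)
  qed
  have "Ck_on (Suc (Suc 0)) W G"
    using assms(1) unfolding smooth_on_def by blast
  then have "F differentiable (at 0)"
    using assms(2) by (simp add: F_def[abs_def])
  then obtain F' where F': "(F has_derivative F') (at 0)"
    by (auto simp: differentiable_def)
  then obtain d where d: "d > 0" "\<And>y. norm y < d \<Longrightarrow> norm (F y - F 0 - F' y) \<le> norm y"
    unfolding has_derivative_at_alt by (metis diff_zero mult_1 zero_less_one)
  obtain B where B: "B > 0" "\<And>y. norm (F' y) \<le> norm y * B"
    using bounded_linear.pos_bounded[OF has_derivative_bounded_linear[OF F']] by blast
  define \<delta> where "\<delta> = min (\<delta>\<^sub>1 / 2) (d / (2 * (norm u + 1)))"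
  have \<delta>: "\<delta> > 0" "\<delta> < \<delta>\<^sub>1" "\<delta> * norm u < d"
  proof -
    show "\<delta> > 0" "\<delta> < \<delta>\<^sub>1"
      using \<open>\<delta>\<^sub>1 > 0\<close> d(1) by (auto simp: \<delta>_def min_less_iff_disj add_nonneg_pos)
    then have "\<delta> * norm u \<le> \<delta> * (norm u + 1)"
      by simp
    also have "\<delta> * (norm u + 1) \<le> d / (2 * (norm u + 1)) * (norm u + 1)"
      by (intro mult_right_mono) (auto simp: \<delta>_def)
    also have "\<dots> = d / 2"
      by (simp add: field_simps add_nonneg_eq_0_iff)
    finally show "\<delta> * norm u < d"
      using d(1) by simp
  qed
  define K where "K = (1 + B) * norm u"
  have lip: "norm (F (t *\<^sub>R u) - F 0) \<le> K * \<bar>t\<bar>" if "\<bar>t\<bar> \<le> \<delta>" for t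
  proof -
    have "\<bar>t\<bar> * norm u \<le> \<delta> * norm u"
      using that by (intro mult_right_mono) auto
    then have "norm (t *\<^sub>R u) < d"
      using \<delta>(3) by simp
    from d(2)[OF this] have "norm (F (t *\<^sub>R u) - F 0) \<le> norm (t *\<^sub>R u) + norm (F' (t *\<^sub>R u))"
      using norm_triangle_ineq[of "F (t *\<^sub>R u) - F 0 - F' (t *\<^sub>R u)" "F' (t *\<^sub>R u)"] by simp
    also have "\<dots> \<le> K * \<bar>t\<bar>"
      using B(2)[of "t *\<^sub>R u"] by (simp add: K_def algebra_simps)
    finally show ?thesis .
  qed
  show ?thesis
  proof (rule that[OF \<delta>(1), of K "F 0"])
    show "K \<ge> 0"
      using B(1) by (simp add: K_def)
    fix r s t assume *: "\<bar>s\<bar> \<le> r" "\<bar>t\<bar> \<le> r" "r \<le> \<delta>"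
    have "norm (G (t *\<^sub>R u) - G (s *\<^sub>R u) - (t - s) *\<^sub>R F (0 *\<^sub>R u)) \<le> norm (t - s) * (K * r)"
    proof (rule vector_differentiable_bound_linearization[where S = "{-r..r}"])
      fix x assume "x \<in> {-r..r}"
      then have x: "\<bar>x\<bar> \<le> r"
        by auto
      then show "((\<lambda>t. G (t *\<^sub>R u)) has_vector_derivative F (x *\<^sub>R u)) (at x within {-r..r})"
        using * \<delta>(2) by (intro der) auto
      have "norm (F (x *\<^sub>R u) - F 0) \<le> K * \<bar>x\<bar>"
        using lip x * by auto
      also have "\<dots> \<le> K * r"
        using x \<open>K \<ge> 0\<close> by (intro mult_left_mono) auto
      finally show "norm (F (x *\<^sub>R u) - F (0 *\<^sub>R u)) \<le> K * r"
        by simp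
    qed (use * in \<open>auto simp: closed_segment_eq_real_ivl\<close>)
    then show "norm (G (t *\<^sub>R u) - G (s *\<^sub>R u) - (t - s) *\<^sub>R F 0) \<le> K * r * \<bar>t - s\<bar>"
      by (simp add: mult.commute)
  qed
qed

lemma represents_S_local:
  assumes "represents_S n S"
  obtains r where "r > 0"
    "\<And>z w. cmod z < r \<Longrightarrow> cmod w < r \<Longrightarrow>
      (z, w) \<in> S \<longleftrightarrow> (\<exists>t. w = of_real t + of_real (g_exp n t) * z)"
proof -
  obtain T Z W where T: "open T" "0 \<in> T" and Z: "open Z" "0 \<in> Z" and W: "open W" "0 \<in> W"
    and eq: "S \<inter> W = leaf_union n T Z \<inter> W"
    using assms by (auto simp: represents_S_def same_germ_at_def)
  obtain a b c where abc: "a > 0" "ball 0 a \<subseteq> T" "b > 0" "ball 0 b \<subseteq> Z" "c > 0" "ball 0 c \<subseteq> W"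
    using T Z W open_contains_ball by metis
  define r where "r = min (a / 2) (min b (c / 2))"
  show ?thesis
  proof (rule that)
    show "r > 0"
      using abc by (simp add: r_def)
    fix z w assume zw: "cmod z < r" "cmod w < r"
    have "norm (z, w) < c"
      using norm_Pair_le[of z w] zw by (simp add: r_def)
    then have inW: "(z, w) \<in> W"
      using abc by auto
    have inZ: "z \<in> Z"
      using abc zw by (auto simp: r_def)
    have inT: "t \<in> T" if t: "w = of_real t + of_real (g_exp n t) * z" for t
    proof -
      have "\<bar>t\<bar> = cmod (w - of_real (g_exp n t) * z)"
        using t by simp
      also have "\<dots> \<le> cmod w + g_exp n t * cmod z"
        using norm_triangle_ineq4[of w "of_real (g_exp n t) * z"] by (simp add: norm_mult g_exp_nonneg)
      also have "\<dots> \<le> cmod w + 1 * cmod z"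
        using g_exp_less_1[of n t] by (intro add_left_mono mult_right_mono) auto
      also have "\<dots> < a"
        using zw by (simp add: r_def)
      finally show ?thesis
        using abc by auto
    qed
    have "(z, w) \<in> S \<longleftrightarrow> (z, w) \<in> leaf_union n T Z"
      using eq inW by blast
    also have "\<dots> \<longleftrightarrow> (\<exists>t. w = of_real t + of_real (g_exp n t) * z)"
      using inZ inT by (auto simp: leaf_union_def)
    finally show "(z, w) \<in> S \<longleftrightarrow> (\<exists>t. w = of_real t + of_real (g_exp n t) * z)" .
  qed
qed

section \<open>Images of leaves under smooth CR maps\<close>

lemma leaf_direction_tangent:
  assumes "open N" "(z, w) \<in> N" "w = of_real t + of_real (g_exp n t) * z"
    and leaf: "\<And>z. (z, of_real t + of_real (g_exp n t) * z) \<in> N \<Longrightarrow>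
      (z, of_real t + of_real (g_exp n t) * z) \<in> M"
  shows "(c, of_real (g_exp n t) * c) \<in> tangent_space M (z, w)"
proof -
  define \<gamma> where "\<gamma> s = (z + s *\<^sub>R c, complex_of_real t + of_real (g_exp n t) * (z + s *\<^sub>R c))" for s :: real
  have cont: "isCont \<gamma> s" for s
    unfolding \<gamma>_def[abs_def] by (intro continuous_intros)
  have "\<gamma> 0 = (z, w)"
    by (simp add: \<gamma>_def assms(3))
  moreover have "\<forall>\<^sub>F s in at 0. \<gamma> s \<in> N"
    using cont[of 0] topological_tendstoD[of \<gamma> "\<gamma> 0" "at 0" N] assms(1,2) \<open>\<gamma> 0 = (z, w)\<close>
    by (simp add: isCont_def)
  then have "\<forall>\<^sub>F s in at 0. \<gamma> s \<in> M"
    by eventually_elim (unfold \<gamma>_def, rule leaf)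
  moreover have "(\<gamma> has_vector_derivative (c, of_real (g_exp n t) * c)) (at 0)"
    unfolding \<gamma>_def[abs_def] has_vector_derivative_def
    by (auto simp: scaleR_conv_of_real algebra_simps intro!: derivative_eq_intros)
  ultimately show ?thesis
    by (auto simp: tangent_space_def)
qed

lemma leaf_direction_complex_tangent:
  assumes "open N" "(z, w) \<in> N" "w = of_real t + of_real (g_exp n t) * z"
    and leaf: "\<And>z. (z, of_real t + of_real (g_exp n t) * z) \<in> N \<Longrightarrow>
      (z, of_real t + of_real (g_exp n t) * z) \<in> M"
  shows "(1, of_real (g_exp n t)) \<in> complex_tangent_space M (z, w)"
proof -
  have "(1, of_real (g_exp n t)) \<in> tangent_space M (z, w)"
    using leaf_direction_tangent[OF assms, of 1] by simp
  moreover have "(1, of_real (g_exp n t)) = mult_i (- \<i>, of_real (g_exp n t) * (- \<i>))"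
    by (simp add: mult_i_def complex_eq_iff)
  ultimately show ?thesis
    using leaf_direction_tangent[OF assms, of "- \<i>"] by (simp add: complex_tangent_space_def)
qed

text \<open>The curve \<open>p\<close> runs in a leaf over real \<open>z\<close>, with velocity in
  the complex tangent space. The CR condition puts the velocity of the image into the complex
  tangent space of \<open>M'\<close>, which is the leaf direction, so the parameter of the image
  leaf is constant.\<close>

lemma smooth_CR_map_leaf_into_leaf:
  assumes CR: "smooth_CR_map M M' \<Phi>" and m: "m \<ge> 1" and "open N"
    and leaf: "\<And>z. (z, of_real t + of_real (g_exp n t) * z) \<in> N \<Longrightarrow>
      (z, of_real t + of_real (g_exp n t) * z) \<in> M"
    and leaf': "\<And>z w. (z, w) \<in> M' \<Longrightarrow> cmod z < r \<Longrightarrow> cmod w < r \<Longrightarrow>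
      \<exists>t. w = of_real t + of_real (g_exp m t) * z"
    and I: "open I" "convex I" "a \<in> I" "b \<in> I"
    and seg: "\<And>x. x \<in> I \<Longrightarrow> (of_real x, of_real t + of_real (g_exp n t) * of_real x) \<in> N"
    and small: "\<And>x. x \<in> I \<Longrightarrow> norm (\<Phi> (of_real x, of_real t + of_real (g_exp n t) * of_real x)) <
      min r (1 / (16 * real m))"
  shows "\<exists>\<tau>. \<forall>x\<in>{a, b}. snd (\<Phi> (of_real x, of_real t + of_real (g_exp n t) * of_real x)) =
      of_real \<tau> + of_real (g_exp m \<tau>) * fst (\<Phi> (of_real x, of_real t + of_real (g_exp n t) * of_real x))"
proof -
  define p :: "real \<Rightarrow> C2" where "p x = (of_real x, of_real t + of_real (g_exp n t) * of_real x)" for x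
  define \<tau> where "\<tau> x = leaf_param m (fst (\<Phi> (p x))) (snd (\<Phi> (p x)))" for x
  have pM: "p x \<in> M" if "x \<in> I" for x
    using leaf seg[OF that] by (simp add: p_def)
  have cont_p: "continuous_on X p" for X
    unfolding p_def by (intro continuous_intros)
  have fst_snd: "cmod (fst (\<Phi> (p x))) < r" "cmod (snd (\<Phi> (p x))) < r"
    "cmod (fst (\<Phi> (p x))) < 1 / (16 * real m)" if "x \<in> I" for x
    using small[OF that] norm_fst_le[of "fst (\<Phi> (p x))" "snd (\<Phi> (p x))"]
      norm_snd_le[of "snd (\<Phi> (p x))" "fst (\<Phi> (p x))"]
    by (auto simp: p_def)
  have on: "snd (\<Phi> (p x)) = of_real (\<tau> x) + of_real (g_exp m (\<tau> x)) * fst (\<Phi> (p x))"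
    if x: "x \<in> I" for x
  proof -
    have "(fst (\<Phi> (p x)), snd (\<Phi> (p x))) \<in> M'"
      using CR pM[OF x] by (auto simp: smooth_CR_map_def)
    then obtain s where "snd (\<Phi> (p x)) = of_real s + of_real (g_exp m s) * fst (\<Phi> (p x))"
      using leaf' fst_snd[OF x] by blast
    then show ?thesis
      using leaf_param_eqI[OF m less_imp_le[OF fst_snd(3)[OF x]]] unfolding \<tau>_def by metis
  qed
  have "\<exists>v. ((\<lambda>x. \<Phi> (p x)) has_vector_derivative v) (at x) \<and>
      snd v = of_real (g_exp m (\<tau> x)) * fst v" if x: "x \<in> I" for x
  proof -
    obtain W G where G: "p x \<in> W" "smooth_on W G" "\<And>q. q \<in> M \<inter> W \<Longrightarrow> G q = \<Phi> q"
      and tan: "\<And>v. v \<in> complex_tangent_space M (p x) \<Longrightarrow>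
        frechet_derivative G (at (p x)) v \<in> complex_tangent_space M' (\<Phi> (p x))"
      using CR pM[OF x] unfolding smooth_CR_map_def by meson
    \<comment> \<open>The derivative is taken of the ambient extension \<open>G\<close>; it is also
      the velocity of the image curve because \<open>G\<close> and \<open>\<Phi>\<close> agree along
      \<open>p\<close>, which stays in \<open>M\<close>.\<close>
    define v where "v = frechet_derivative G (at (p x)) (1, of_real (g_exp n t))"
    have "(p has_vector_derivative (1, of_real (g_exp n t))) (at x)"
      unfolding p_def[abs_def] has_vector_derivative_def
      by (auto simp: scaleR_conv_of_real algebra_simps intro!: derivative_eq_intros)
    moreover have "(G has_derivative frechet_derivative G (at (p x))) (at (p x) within p ` UNIV)"
      using smooth_on_has_derivative[OF G(2,1)] by (rule has_derivative_at_withinI)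
    ultimately have "(G \<circ> p has_vector_derivative v) (at x)"
      unfolding v_def by (rule vector_derivative_diff_chain_within)
    moreover have "open (I \<inter> p -` W)"
      using G(2) I(1) by (intro open_Int continuous_open_vimage) (use cont_p[of UNIV] in \<open>auto simp: smooth_on_def continuous_on_eq_continuous_at\<close>)
    ultimately have "((\<lambda>x. \<Phi> (p x)) has_vector_derivative v) (at x)"
      by (rule has_vector_derivative_transform_within_open) (use x G pM in auto)
    moreover have "snd v = of_real (g_exp m (\<tau> x)) * fst v"
    proof (rule complex_tangent_space_leaf[OF m leaf'])
      show "v \<in> complex_tangent_space M' (fst (\<Phi> (p x)), snd (\<Phi> (p x)))"
        unfolding v_def prod.collapse
        by (rule tan) (unfold p_def, rule leaf_direction_complex_tangent[OF \<open>open N\<close> seg[OF x] refl leaf])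
    qed (use fst_snd[OF x] on[OF x] in auto)
    ultimately show ?thesis
      by blast
  qed
  then obtain v where "\<And>x. x \<in> I \<Longrightarrow> ((\<lambda>x. \<Phi> (p x)) has_vector_derivative v x) (at x)"
    "\<And>x. x \<in> I \<Longrightarrow> snd (v x) = of_real (g_exp m (\<tau> x)) * fst (v x)"
    by metis
  then have "\<tau> a = \<tau> b"
    using leaf_param_constant_along_tangent_curve[OF m I(1,2), of "\<lambda>x. \<Phi> (p x)" \<tau> v a b]
      on fst_snd(3) I(3,4) by (simp add: less_imp_le)
  then show ?thesis
    using on[OF I(3)] on[OF I(4)] by (intro exI[of _ "\<tau> a"]) (auto simp: p_def)
qed

text \<open>Commuting with \<open>mult_i\<close> makes \<open>D\<close> complex linear, so on the
  second factor it is multiplication by the complex vector \<open>D (0, 1)\<close>. This turns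
  \<open>holomorphic_map_on\<close> into one-variable holomorphy on slices.\<close>

lemma mult_i_linear_slice:
  assumes "bounded_linear D" "\<And>v. D (mult_i v) = mult_i (D v)"
  shows "D (0, k) = (fst (D (0, 1)) * k, snd (D (0, 1)) * k)"
proof -
  interpret bounded_linear D by fact
  have "(0, k) = Re k *\<^sub>R (0, 1) + Im k *\<^sub>R mult_i (0, 1 :: complex)"
    by (simp add: mult_i_def complex_eq_iff)
  then have "D (0, k) = Re k *\<^sub>R D (0, 1) + Im k *\<^sub>R mult_i (D (0, 1))"
    using assms(2) by (metis add scale)
  then show ?thesis
    by (simp add: mult_i_def prod_eq_iff complex_eq_iff algebra_simps)
qed

lemma holomorphic_map_slice:
  assumes "holomorphic_map_on V F" "\<And>w. w \<in> A \<Longrightarrow> (z, w) \<in> V"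
  shows "(\<lambda>w. fst (F (z, w))) holomorphic_on A" "(\<lambda>w. snd (F (z, w))) holomorphic_on A"
proof -
  have "((\<lambda>w. fst (F (z, w))) field_differentiable (at w)) \<and>
    ((\<lambda>w. snd (F (z, w))) field_differentiable (at w))" if "w \<in> A" for w
  proof -
    have "\<exists>D. (F has_derivative D) (at (z, w)) \<and> (\<forall>v. D (mult_i v) = mult_i (D v))"
      using assms(1)[unfolded holomorphic_map_on_def] assms(2)[OF that] by (rule bspec)
    then obtain D where D: "(F has_derivative D) (at (z, w))" "\<forall>v. D (mult_i v) = mult_i (D v)"
      by (elim exE conjE)
    have "((\<lambda>w. (z, w)) has_derivative (\<lambda>k. (0, k))) (at w)"
      by (rule has_derivative_Pair[OF has_derivative_const has_derivative_ident])
    from has_derivative_compose[OF this D(1)]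
    have F: "((\<lambda>w. F (z, w)) has_derivative (\<lambda>k. D (0, k))) (at w)" .
    have D01: "(\<lambda>k. D (0, k)) = (\<lambda>k. (fst (D (0, 1)) * k, snd (D (0, 1)) * k))"
      by (rule ext) (rule mult_i_linear_slice[OF has_derivative_bounded_linear[OF D(1)] D(2)[rule_format]])
    have F': "((\<lambda>w. F (z, w)) has_derivative (\<lambda>k. (fst (D (0, 1)) * k, snd (D (0, 1)) * k))) (at w)"
      using F by (subst (asm) D01)
    show ?thesis
      using has_derivative_fst[OF F'] has_derivative_snd[OF F']
      unfolding field_differentiable_def has_field_derivative_def fst_conv snd_conv
      by (intro conjI exI[of _ "fst (D (0, 1))"] exI[of _ "snd (D (0, 1))"])
  qed
  then show "(\<lambda>w. fst (F (z, w))) holomorphic_on A" "(\<lambda>w. snd (F (z, w))) holomorphic_on A"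
    unfolding holomorphic_on_def by (simp_all add: field_differentiable_at_within)
qed

lemma component_contains_connected:
  assumes "U \<in> components (X - S)" "connected C" "C \<subseteq> X" "C \<inter> S = {}" "p \<in> C" "p \<in> U"
  shows "C \<subseteq> U"
  using assms components_maximal[of U "X - S" C] by blast

section \<open>Restriction of a hypothetical equivalence to two slices\<close>

theorem proposition3p3:
  fixes n\<^sub>1 n\<^sub>2 :: nat and \<U> S\<^sub>1 S\<^sub>2 U\<^sub>1 U\<^sub>2 :: "C2 set"
  assumes "n\<^sub>1 \<ge> 1" and "n\<^sub>2 \<ge> 1"
    and "open \<U>" and "connected \<U>"
    and "levi_flat_side \<U> S\<^sub>1 U\<^sub>1" and "levi_flat_side \<U> S\<^sub>2 U\<^sub>2"
    and "represents_S n\<^sub>1 S\<^sub>1" and "represents_S n\<^sub>2 S\<^sub>2"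
    and "upper_side U\<^sub>1" and "upper_side U\<^sub>2"
    and "n\<^sub>1 \<noteq> n\<^sub>2"
  shows "\<not> locally_equivalent (S\<^sub>1, U\<^sub>1) (S\<^sub>2, U\<^sub>2)"
proof
  assume "locally_equivalent (S\<^sub>1, U\<^sub>1) (S\<^sub>2, U\<^sub>2)"
  then obtain V\<^sub>1 V\<^sub>2 \<Phi> where V\<^sub>1: "open V\<^sub>1" "0 \<in> V\<^sub>1"
    and bihol: "biholomorphism (V\<^sub>1 \<inter> U\<^sub>1) (V\<^sub>2 \<inter> U\<^sub>2) \<Phi>"
    and cont: "continuous_on ((V\<^sub>1 \<inter> U\<^sub>1) \<union> (S\<^sub>1 \<inter> V\<^sub>1)) \<Phi>"
    and CR: "smooth_CR_map (S\<^sub>1 \<inter> V\<^sub>1) (S\<^sub>2 \<inter> V\<^sub>2) \<Phi>" and "\<Phi> 0 = 0"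
    unfolding locally_equivalent_def prod.case by (elim exE conjE)
  have hol: "holomorphic_map_on (V\<^sub>1 \<inter> U\<^sub>1) \<Phi>" and inj: "inj_on \<Phi> (V\<^sub>1 \<inter> U\<^sub>1)"
    and image: "\<Phi> ` (V\<^sub>1 \<inter> U\<^sub>1) = V\<^sub>2 \<inter> U\<^sub>2"
    using bihol by (auto simp: biholomorphism_def bij_betw_def)
  have "0 \<in> S\<^sub>1" "S\<^sub>1 \<subseteq> \<U>" and comp: "U\<^sub>1 \<in> components (\<U> - S\<^sub>1)"
    and U\<^sub>2: "U\<^sub>2 \<inter> S\<^sub>2 = {}"
    using assms(5,6) closedin_imp_subset in_components_subset
    by (fastforce simp: levi_flat_side_def)+
  obtain r\<^sub>1 where r\<^sub>1: "r\<^sub>1 > 0" "\<And>z w. cmod z < r\<^sub>1 \<Longrightarrow> cmod w < r\<^sub>1 \<Longrightarrow>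
      (z, w) \<in> S\<^sub>1 \<longleftrightarrow> (\<exists>t. w = of_real t + of_real (g_exp n\<^sub>1 t) * z)"
    using represents_S_local[OF assms(7)] by blast
  obtain r\<^sub>2 where r\<^sub>2: "r\<^sub>2 > 0" "\<And>z w. cmod z < r\<^sub>2 \<Longrightarrow> cmod w < r\<^sub>2 \<Longrightarrow>
      (z, w) \<in> S\<^sub>2 \<longleftrightarrow> (\<exists>t. w = of_real t + of_real (g_exp n\<^sub>2 t) * z)"
    using represents_S_local[OF assms(8)] by blast
  obtain \<epsilon> where \<epsilon>: "\<epsilon> > 0" "\<And>\<eta>. cmod \<eta> < \<epsilon> \<Longrightarrow> 0 < Im \<eta> \<Longrightarrow> (0, \<eta>) \<in> U\<^sub>1"
    using assms(9) by (auto simp: upper_side_def)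
  define E where "E = (V\<^sub>1 \<inter> U\<^sub>1) \<union> (S\<^sub>1 \<inter> V\<^sub>1)"
  \<comment> \<open>Images of norm below \<open>\<mu>\<close> lie where the second hypersurface is
    known to be a union of leaves and where its leaf parameter is defined.\<close>
  define \<mu> where "\<mu> = min r\<^sub>2 (1 / (16 * real n\<^sub>2))"
  have "\<mu> > 0"
    using r\<^sub>2 assms(2) by (simp add: \<mu>_def)
  obtain \<delta>\<^sub>c where \<delta>\<^sub>c: "\<delta>\<^sub>c > 0" "\<And>p. p \<in> E \<Longrightarrow> norm p < \<delta>\<^sub>c \<Longrightarrow> norm (\<Phi> p) < \<mu>"
  proof -
    have "\<exists>\<delta>>0. \<forall>p\<in>E. dist p 0 < \<delta> \<longrightarrow> dist (\<Phi> p) (\<Phi> 0) < \<mu>"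
      using cont \<open>\<mu> > 0\<close> \<open>0 \<in> S\<^sub>1\<close> V\<^sub>1(2) unfolding continuous_on_iff E_def by blast
    then show ?thesis
      using that \<open>\<Phi> 0 = 0\<close> by auto
  qed
  obtain W G where G: "0 \<in> W" "smooth_on W G" "\<And>q. q \<in> S\<^sub>1 \<inter> V\<^sub>1 \<inter> W \<Longrightarrow> G q = \<Phi> q"
  proof -
    have "0 \<in> S\<^sub>1 \<inter> V\<^sub>1"
      using \<open>0 \<in> S\<^sub>1\<close> V\<^sub>1(2) by blast
    from bspec[OF conjunct2[OF CR[unfolded smooth_CR_map_def]] this] show ?thesis
      by (elim exE conjE) (rule that, blast+)
  qed
  obtain \<delta> K d where \<delta>: "\<delta> > 0" "K \<ge> 0" "\<And>r s t. \<bar>s\<bar> \<le> r \<Longrightarrow> \<bar>t\<bar> \<le> r \<Longrightarrow> r \<le> \<delta> \<Longrightarrow>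
      norm (G (t *\<^sub>R (0, 1)) - G (s *\<^sub>R (0, 1)) - (t - s) *\<^sub>R d) \<le> K * r * \<bar>t - s\<bar>"
    using smooth_on_line_quadratic_bound[OF G(2,1), of "(0, 1)"] by blast
  have "open (V\<^sub>1 \<inter> \<U> \<inter> W)"
    using V\<^sub>1 assms(3) G(2) by (auto simp: smooth_on_def)
  then obtain e\<^sub>0 where e\<^sub>0: "e\<^sub>0 > 0" "ball 0 e\<^sub>0 \<subseteq> V\<^sub>1 \<inter> \<U> \<inter> W"
    using V\<^sub>1(2) G(1) \<open>0 \<in> S\<^sub>1\<close> \<open>S\<^sub>1 \<subseteq> \<U>\<close> open_contains_ball by (metis IntI subsetD)
  define e where "e = Min {e\<^sub>0, r\<^sub>1, \<delta>\<^sub>c, \<epsilon>}"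
  have e: "e > 0" "e \<le> e\<^sub>0" "e \<le> r\<^sub>1" "e \<le> \<delta>\<^sub>c" "e \<le> \<epsilon>"
    using e\<^sub>0 r\<^sub>1 \<delta>\<^sub>c \<epsilon> by (auto simp: e_def)
  have near: "(z, w) \<in> V\<^sub>1" "(z, w) \<in> \<U>" "(z, w) \<in> W" "cmod z < r\<^sub>1" "cmod w < r\<^sub>1"
    "norm (z, w) < \<delta>\<^sub>c" if "cmod z + cmod w < e" for z w
  proof -
    have *: "norm (z, w) < e"
      using norm_Pair_le[of z w] that by linarith
    then have "(z, w) \<in> ball 0 e\<^sub>0"
      using e by simp
    then show "(z, w) \<in> V\<^sub>1" "(z, w) \<in> \<U>" "(z, w) \<in> W"
      using e\<^sub>0 by blast+
    show "norm (z, w) < \<delta>\<^sub>c"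
      using * e by simp
    show "cmod z < r\<^sub>1" "cmod w < r\<^sub>1"
      using that e norm_ge_zero[of z] norm_ge_zero[of w] by linarith+
  qed
  \<comment> \<open>The points of both slices, and the leaf segments over real \<open>z\<close>
    joining them, stay within the region controlled by \<open>e\<close>; \<open>R\<close> also
    respects the range of the estimate for \<open>G\<close>, and \<open>x\<close> the contraction
    radius of \<open>leaf_param\<close>.\<close>
  define R where "R = min (e / 4) \<delta>"
  define x where "x = min (e / 8) (1 / (16 * real n\<^sub>1))"
  have R: "R > 0" "R \<le> e / 4" "R \<le> \<delta>"
    using e \<delta> by (auto simp: R_def)
  have x: "0 < x" "x \<le> 1 / (16 * real n\<^sub>1)" "x \<le> e / 8"
    using e assms(1) by (auto simp: x_def)
  have slice_near: "cmod (of_real y) + cmod w < e" if "y \<in> {0..x}" "w \<in> half_disc R" for y w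
    using that R x e by (auto simp: mem_half_disc)
  \<comment> \<open>The point is joined to \<open>(0, w)\<close>, which belongs to the chosen side,
    by a segment with real first coordinate. Over a real first coordinate the leaves have real
    second coordinate, so the segment misses the hypersurface.\<close>
  have inner: "(of_real y, w) \<in> V\<^sub>1 \<inter> U\<^sub>1" if y: "y \<in> {0..x}" and w': "w \<in> half_disc R" "0 < Im w" for y w
  proof -
    define C where "C = (\<lambda>y. (complex_of_real y, w)) ` {0..x}"
    have "connected C"
      unfolding C_def by (intro connected_continuous_image continuous_intros connected_Icc)
    moreover have "C \<subseteq> \<U>"
      using near(2)[OF slice_near] w' by (auto simp: C_def)
    moreover have "C \<inter> S\<^sub>1 = {}"
    proof -
      have "(of_real y, w) \<notin> S\<^sub>1" if "y \<in> {0..x}" for y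
        using r\<^sub>1(2) near(4,5)[OF slice_near[OF that w'(1)]] w'(2) by auto
      then show ?thesis
        by (auto simp: C_def)
    qed
    moreover have "(0, w) \<in> C"
      using x unfolding C_def by (intro image_eqI[of _ _ 0]) auto
    moreover have "(0, w) \<in> U\<^sub>1"
      using w' R e by (intro \<epsilon>) (auto simp: mem_half_disc)
    ultimately have "C \<subseteq> U\<^sub>1"
      using component_contains_connected[OF comp] by blast
    then show ?thesis
      using y near(1)[OF slice_near[OF y w'(1)]] by (auto simp: C_def)
  qed
  \<comment> \<open>For real coordinates the leaf equation has no imaginary part, so
    \<open>leaf_param\<close> solves it completely.\<close>
  have boundary: "(of_real y, of_real s) \<in> S\<^sub>1 \<inter> V\<^sub>1" if "y \<in> {0..x}" "\<bar>s\<bar> \<le> R" for y s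
  proof -
    have s: "of_real s \<in> half_disc R"
      using that by (simp add: mem_half_disc)
    have "cmod (of_real y) \<le> 1 / (16 * real n\<^sub>1)"
      using that x by simp
    then have "of_real s = complex_of_real t + of_real (g_exp n\<^sub>1 t) * of_real y"
      if "t = leaf_param n\<^sub>1 (of_real y) (of_real s)" for t
      using leaf_param[OF assms(1), of "of_real y" "of_real s"] that
      by (metis Re_complex_of_real of_real_add of_real_mult)
    then show ?thesis
      using r\<^sub>1(2) near[OF slice_near[OF that(1) s]] by blast
  qed
  have inE: "(of_real y, w) \<in> E" if "y \<in> {0..x}" "w \<in> half_disc R" for y w
  proof (cases "0 < Im w")
    case True
    then show ?thesis
      using inner[OF that] by (simp add: E_def)
  next
    case False
    then have "w = of_real (Re w)" "\<bar>Re w\<bar> \<le> R"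
      using that abs_Re_le_cmod[of w] by (auto simp: mem_half_disc complex_eq_iff)
    then show ?thesis
      using boundary[OF that(1), of "Re w"] unfolding E_def by auto
  qed
  have small: "norm (\<Phi> (of_real y, w)) < \<mu>" if "y \<in> {0..x}" "w \<in> half_disc R" for y w
    by (rule \<delta>\<^sub>c(2)[OF inE[OF that] near(6)[OF slice_near[OF that]]])
  define a where "a y w = fst (\<Phi> (of_real y, w))" for y w
  define h where "h y w = snd (\<Phi> (of_real y, w))" for y w
  have ah: "\<Phi> (of_real y, w) = (a y w, h y w)" for y w
    by (simp add: a_def h_def)
  have a_small: "cmod (a y w) < \<mu>" and h_small: "cmod (h y w) < \<mu>"
    if "y \<in> {0..x}" "w \<in> half_disc R" for y w
    using small[OF that] norm_fst_le[of "a y w" "h y w"] norm_snd_le[of "h y w" "a y w"]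
    unfolding ah by linarith+
  have hol_slice: "a y holomorphic_on interior (half_disc R)" "h y holomorphic_on interior (half_disc R)"
    if "y \<in> {0..x}" for y
  proof -
    have "(of_real y, w) \<in> V\<^sub>1 \<inter> U\<^sub>1" if "w \<in> interior (half_disc R)" for w
      using inner[OF \<open>y \<in> {0..x}\<close>] that by (simp add: interior_half_disc mem_half_disc)
    then show "a y holomorphic_on interior (half_disc R)" "h y holomorphic_on interior (half_disc R)"
      unfolding a_def[abs_def] h_def[abs_def] by (intro holomorphic_map_slice[OF hol]; simp)+
  qed
  have cont_slice: "continuous_on (half_disc R) (a y)" "continuous_on (half_disc R) (h y)"
    if "y \<in> {0..x}" for y
  proof -
    have "continuous_on (half_disc R) (\<lambda>w. \<Phi> (of_real y, w))"
      by (rule continuous_on_compose2[OF cont]) (use inE[OF that] in \<open>auto simp: E_def intro!: continuous_intros\<close>)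
    then show "continuous_on (half_disc R) (a y)" "continuous_on (half_disc R) (h y)"
      unfolding a_def[abs_def] h_def[abs_def] by (auto intro: continuous_on_fst continuous_on_snd)
  qed
  have ends: "0 \<in> {0..x}" "x \<in> {0..x}"
    using x by auto
  \<comment> \<open>One \<open>\<tau>\<close> serves both slices because their boundary points lie
    on the same leaf. The open interval of radius \<open>e / 4\<close> contains 0 and
    \<open>x\<close>, so the image curve can be differentiated at both.\<close>
  have leaves: "\<exists>\<tau>. h 0 (of_real t) = of_real \<tau> + of_real (g_exp n\<^sub>2 \<tau>) * a 0 (of_real t) \<and>
      h x (of_real (t + g_exp n\<^sub>1 t * x)) =
        of_real \<tau> + of_real (g_exp n\<^sub>2 \<tau>) * a x (of_real (t + g_exp n\<^sub>1 t * x))"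
    if t: "\<bar>t\<bar> \<le> R" for t
  proof -
    define N where "N = V\<^sub>1 \<inter> {p. cmod (fst p) < r\<^sub>1} \<inter> {p. cmod (snd p) < r\<^sub>1}"
    have seg: "cmod (of_real y) + cmod (of_real t + of_real (g_exp n\<^sub>1 t) * of_real y) < e"
      if "\<bar>y\<bar> < e / 4" for y
    proof -
      have "cmod (of_real t + of_real (g_exp n\<^sub>1 t) * of_real y) \<le> \<bar>t\<bar> + g_exp n\<^sub>1 t * \<bar>y\<bar>"
        by (rule order_trans[OF norm_triangle_ineq]) (simp add: norm_mult g_exp_nonneg)
      also have "g_exp n\<^sub>1 t * \<bar>y\<bar> \<le> 1 * \<bar>y\<bar>"
        using g_exp_less_1[of n\<^sub>1 t] by (intro mult_right_mono) auto
      finally show ?thesis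
        using that t R e by simp
    qed
    have leaf: "(z, of_real t + of_real (g_exp n\<^sub>1 t) * z) \<in> S\<^sub>1 \<inter> V\<^sub>1"
      if "(z, of_real t + of_real (g_exp n\<^sub>1 t) * z) \<in> N" for z
      using that r\<^sub>1(2) by (auto simp: N_def)
    have segN: "(of_real y, of_real t + of_real (g_exp n\<^sub>1 t) * of_real y) \<in> N" if "\<bar>y\<bar> < e / 4" for y
      using near[OF seg[OF that]] by (simp add: N_def)
    have "\<exists>\<tau>. \<forall>y\<in>{0, x}. snd (\<Phi> (of_real y, of_real t + of_real (g_exp n\<^sub>1 t) * of_real y)) = of_real \<tau> +
        of_real (g_exp n\<^sub>2 \<tau>) * fst (\<Phi> (of_real y, of_real t + of_real (g_exp n\<^sub>1 t) * of_real y))"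
    proof (rule smooth_CR_map_leaf_into_leaf[OF CR assms(2) _ leaf])
      show "open N"
        unfolding N_def using V\<^sub>1(1) by (intro open_Int open_Collect_less continuous_intros)
      show "\<exists>t. w = of_real t + of_real (g_exp n\<^sub>2 t) * z"
        if "(z, w) \<in> S\<^sub>2 \<inter> V\<^sub>2" "cmod z < r\<^sub>2" "cmod w < r\<^sub>2" for z w
        using r\<^sub>2(2) that by blast
      show "open {- (e / 4)<..<e / 4}" "convex {- (e / 4)<..<e / 4}"
        by auto
      show "0 \<in> {- (e / 4)<..<e / 4}" "x \<in> {- (e / 4)<..<e / 4}"
        using e x by auto
      fix y assume "y \<in> {- (e / 4)<..<e / 4}"
      then have y: "\<bar>y\<bar> < e / 4"
        by auto
      show "(of_real y, of_real t + of_real (g_exp n\<^sub>1 t) * of_real y) \<in> N"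
        by (rule segN[OF y])
      have "(of_real y, of_real t + of_real (g_exp n\<^sub>1 t) * of_real y) \<in> E"
        using leaf[OF segN[OF y]] by (simp add: E_def)
      then show "norm (\<Phi> (of_real y, of_real t + of_real (g_exp n\<^sub>1 t) * of_real y)) <
          min r\<^sub>2 (1 / (16 * real n\<^sub>2))"
        using \<delta>\<^sub>c(2) near(6)[OF seg[OF y]] unfolding \<mu>_def by blast
    qed
    then show ?thesis
      by (auto simp: a_def h_def)
  qed
  \<comment> \<open>On the diameter of the slice at 0 the extension agrees with
    \<open>\<Phi>\<close>, which passes its regularity on to \<open>a 0\<close> and
    \<open>h 0\<close>.\<close>
  have G_eq: "G (t *\<^sub>R (0, 1)) = (a 0 (of_real t), h 0 (of_real t))" if "\<bar>t\<bar> \<le> R" for t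
  proof -
    have "of_real t \<in> half_disc R"
      using that by (simp add: mem_half_disc)
    from near(3)[OF slice_near[OF ends(1) this]] boundary[OF ends(1) that]
    have "G (of_real 0, of_real t) = \<Phi> (of_real 0, of_real t)"
      by (intro G(3)) auto
    then show ?thesis
      using ah[of 0 "of_real t"] by (simp add: scaleR_conv_of_real)
  qed
  have reg: "cmod (a 0 (of_real t) - a 0 (of_real s) - of_real (t - s) * fst d) \<le> K * r * \<bar>t - s\<bar>"
    "cmod (h 0 (of_real t) - h 0 (of_real s) - of_real (t - s) * snd d) \<le> K * r * \<bar>t - s\<bar>"
    if "\<bar>s\<bar> \<le> r" "\<bar>t\<bar> \<le> r" "r \<le> R" for r s t
  proof -
    define p where "p = G (t *\<^sub>R (0, 1)) - G (s *\<^sub>R (0, 1)) - (t - s) *\<^sub>R d"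
    have "norm p \<le> K * r * \<bar>t - s\<bar>"
      unfolding p_def using that R by (intro \<delta>(3)) auto
    then have "cmod (fst p) \<le> K * r * \<bar>t - s\<bar>" "cmod (snd p) \<le> K * r * \<bar>t - s\<bar>"
      using norm_fst_le[of "fst p" "snd p"] norm_snd_le[of "snd p" "fst p"] by auto
    moreover have "G (t *\<^sub>R (0, 1)) = (a 0 (of_real t), h 0 (of_real t))"
      "G (s *\<^sub>R (0, 1)) = (a 0 (of_real s), h 0 (of_real s))"
      by (rule G_eq; use that in linarith)+
    ultimately show "cmod (a 0 (of_real t) - a 0 (of_real s) - of_real (t - s) * fst d) \<le> K * r * \<bar>t - s\<bar>"
      "cmod (h 0 (of_real t) - h 0 (of_real s) - of_real (t - s) * snd d) \<le> K * r * \<bar>t - s\<bar>"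
      by (simp_all add: p_def scaleR_conv_of_real)
  qed
  have lip_a: "cmod (a 0 (of_real t) - a 0 (of_real s)) \<le> (K * R + cmod (fst d)) * \<bar>t - s\<bar>"
    if "\<bar>s\<bar> \<le> R" "\<bar>t\<bar> \<le> R" for s t
  proof -
    have "cmod (of_real (t - s) * fst d) = cmod (fst d) * \<bar>t - s\<bar>"
      by (simp only: norm_mult norm_of_real mult.commute)
    then show ?thesis
      using reg(1)[OF that order_refl]
        norm_triangle_ineq2[of "a 0 (of_real t) - a 0 (of_real s)" "of_real (t - s) * fst d"]
      by (simp add: distrib_right)
  qed
  obtain \<rho> where \<rho>: "0 < \<rho>" "\<rho> \<le> R" "\<And>w. w \<in> half_disc \<rho> \<Longrightarrow> h x w = h 0 w"
    "\<And>w. w \<in> half_disc \<rho> \<Longrightarrow> a x w = a 0 w"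
  proof (rule slices_agree[OF assms(1,2,11) R(1) x(1,2) hol_slice[OF ends(1)] hol_slice[OF ends(2)]
        cont_slice[OF ends(1)] cont_slice[OF ends(2)] _ _ _ _ _ \<delta>(2) reg(2) lip_a])
    show "cmod (a 0 w) \<le> 1 / (16 * real n\<^sub>2)" "cmod (a x w) \<le> 1 / (16 * real n\<^sub>2)"
      if "w \<in> half_disc R" for w
      using a_small[OF ends(1) that] a_small[OF ends(2) that] by (auto simp: \<mu>_def)
    \<comment> \<open>Interior points are mapped into the second side, which is disjoint from the
      second hypersurface.\<close>
    show "h 0 w \<noteq> of_real t + of_real (g_exp n\<^sub>2 t) * a 0 w" if "w \<in> interior (half_disc R)" for w t
    proof
      assume eq: "h 0 w = of_real t + of_real (g_exp n\<^sub>2 t) * a 0 w"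
      have w: "w \<in> half_disc R" "0 < Im w"
        using that by (auto simp: interior_half_disc mem_half_disc)
      have "(a 0 w, h 0 w) \<in> S\<^sub>2"
        using r\<^sub>2(2) a_small[OF ends(1) w(1)] h_small[OF ends(1) w(1)] eq by (auto simp: \<mu>_def)
      moreover have "(a 0 w, h 0 w) \<in> U\<^sub>2"
        using imageI[OF inner[OF ends(1) w], of \<Phi>] image unfolding ah by auto
      ultimately show False
        using U\<^sub>2 by blast
    qed
    show "h 0 0 = 0"
      using \<open>\<Phi> 0 = 0\<close> by (simp add: h_def zero_prod_def)
  qed (use leaves in auto)
  \<comment> \<open>Any common interior point of the two slices would do: its two copies have the
    same image, against the injectivity of the biholomorphism.\<close>
  define w where "w = \<i> * of_real (\<rho> / 2)"
  have w: "w \<in> half_disc \<rho>" "w \<in> half_disc R" "0 < Im w"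
    using \<rho>(1,2) by (auto simp: w_def mem_half_disc norm_mult)
  have "\<Phi> (of_real x, w) = \<Phi> (of_real 0, w)"
    unfolding ah using \<rho>(3,4)[OF w(1)] by simp
  then have "(complex_of_real x, w) = (of_real 0, w)"
    using inj_onD[OF inj] inner[OF ends(1) w(2,3)] inner[OF ends(2) w(2,3)] by blast
  then show False
    using x(1) by simp
qed

end
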